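(* Fix $\beta=1$ and let $M\in\mathbb N$ be fixed. Let $k=k(N)$ satisfy $$\frac{k}{\sqrt N}\longrightarrow c\in(0,\infty).$$ Let $\mu_N^{(k)}$ be the marginal on $(\sigma_1,\dots,\sigma_k)$ of the Hopfield Gibbs measure $\mu_N$ at inverse temperature $\beta=1$ with $N$ spins and $M$ patterns, and let $\pi$ be the Rademacher law on $\{-1,+1\}$. Then there exists a deterministic constant $b=b(c,M)>0$ such that $$\liminf_{N\to\infty}\ d_{\mathrm{TV}}\big(\mu_N^{(k)},\pi^{\otimes k}\big)\ \ge\ b\qquad\text{in }\mathbb P_\xi\text{-probability},$$ i.e. for every $\delta>0$, $\mathbb P_\xi\big(d_{\mathrm{TV}}(\mu_N^{(k)},\pi^{\otimes k})\ge b-\delta\big)\to 1$ as $N\to\infty$.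
   Context: Hopfield model: let $\xi_i=(\xi_i^1,\dots,\xi_i^M)\in\{-1,+1\}^M$, $i=1,\dots,N$, be i.i.d. random vectors with independent coordinates, $\mathbb E[\xi_i^\nu]=0$ and $\mathbb E[(\xi_i^\nu)^2]=1$; $\mathbb P_\xi$ denotes their law (the disorder). For $\sigma\in\{-1,+1\}^N$ put $m_N(\sigma)=\frac1N\sum_{i=1}^N\sigma_i\xi_i\in\mathbb R^M$. For fixed $\xi$ and $\beta>0$ the Gibbs measure on $\{-1,+1\}^N$ is $\mu_N(\sigma)=\frac1{Z_N}\exp\big(\frac{\beta N}{2}\|m_N(\sigma)\|^2\big)$, where $\|\cdot\|$ is the Euclidean norm and $Z_N$ the normalizing constant; it is a random measure, depending on $\xi$. $\pi(\pm1)=\frac12$. $d_{\mathrm{TV}}(\nu,\varrho)=\sup_A|\nu(A)-\varrho(A)|$. *)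

theory Defs
  imports "HOL-Probability.Probability"
begin

text \<open>
  Patterns are random vectors in \<open>real ^ 'm\<close>; the number of patterns is \<open>CARD('m)\<close>.
\<close>

locale hopfield_disorder = prob_space P
  for P :: "'a measure" and N :: nat and \<xi> :: "nat \<Rightarrow> 'a \<Rightarrow> real ^ 'm" +
  assumes pm_one: "\<And>i \<nu> \<omega>. i \<in> {1..N} \<Longrightarrow> \<omega> \<in> space P \<Longrightarrow> \<xi> i \<omega> $ \<nu> \<in> {-1, 1}"
    and indep_vectors: "indep_vars (\<lambda>_. borel) \<xi> {1..N}"
    and identical: "\<And>i j. i \<in> {1..N} \<Longrightarrow> j \<in> {1..N} \<Longrightarrow> distr P borel (\<xi> i) = distr P borel (\<xi> j)"
    and indep_coordinates:
      "\<And>i. i \<in> {1..N} \<Longrightarrow> indep_vars (\<lambda>_. borel) (\<lambda>\<nu> \<omega>. \<xi> i \<omega> $ \<nu>) UNIV"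
    and mean: "\<And>i \<nu>. i \<in> {1..N} \<Longrightarrow> expectation (\<lambda>\<omega>. \<xi> i \<omega> $ \<nu>) = 0"
    and second_moment: "\<And>i \<nu>. i \<in> {1..N} \<Longrightarrow> expectation (\<lambda>\<omega>. (\<xi> i \<omega> $ \<nu>)\<^sup>2) = 1"

text \<open>
  Extensional functions (\<open>undefined\<close> outside \<open>{1..n}\<close>), so that this set is finite and
  is the space of the product measure \<open>rademacher_power n\<close>.
\<close>

definition spins :: "nat \<Rightarrow> (nat \<Rightarrow> real) set" where
  "spins n = {1..n} \<rightarrow>\<^sub>E {-1, 1}"

definition overlap :: "nat \<Rightarrow> (nat \<Rightarrow> real ^ 'm) \<Rightarrow> (nat \<Rightarrow> real) \<Rightarrow> real ^ 'm" where
  "overlap N x \<sigma> = (1 / real N) *\<^sub>R (\<Sum>i = 1..N. \<sigma> i *\<^sub>R x i)"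

definition gibbs_weight :: "real \<Rightarrow> nat \<Rightarrow> (nat \<Rightarrow> real ^ 'm) \<Rightarrow> (nat \<Rightarrow> real) \<Rightarrow> real" where
  "gibbs_weight \<beta> N x \<sigma> = exp (\<beta> * real N / 2 * (norm (overlap N x \<sigma>))\<^sup>2)"

definition partition_function :: "real \<Rightarrow> nat \<Rightarrow> (nat \<Rightarrow> real ^ 'm) \<Rightarrow> real" where
  "partition_function \<beta> N x = (\<Sum>\<sigma>\<in>spins N. gibbs_weight \<beta> N x \<sigma>)"

definition gibbs :: "real \<Rightarrow> nat \<Rightarrow> (nat \<Rightarrow> real ^ 'm) \<Rightarrow> (nat \<Rightarrow> real) measure" where
  "gibbs \<beta> N x =
    point_measure (spins N) (\<lambda>\<sigma>. ennreal (gibbs_weight \<beta> N x \<sigma> / partition_function \<beta> N x))"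

definition rademacher :: "real measure" where
  "rademacher = uniform_count_measure {-1, 1}"

definition rademacher_power :: "nat \<Rightarrow> (nat \<Rightarrow> real) measure" where
  "rademacher_power k = (\<Pi>\<^sub>M i\<in>{1..k}. rademacher)"

text \<open>Only meaningful for \<open>k \<le> N\<close>.\<close>

definition gibbs_marginal ::
    "real \<Rightarrow> nat \<Rightarrow> (nat \<Rightarrow> real ^ 'm) \<Rightarrow> nat \<Rightarrow> (nat \<Rightarrow> real) measure" where
  "gibbs_marginal \<beta> N x k =
    distr (gibbs \<beta> N x) (\<Pi>\<^sub>M i\<in>{1..k}. count_space {-1, 1}) (\<lambda>\<sigma>. restrict \<sigma> {1..k})"

text \<open>Intended for probability measures on the same measurable space.\<close>

definition tv_dist :: "'b measure \<Rightarrow> 'b measure \<Rightarrow> real" where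
  "tv_dist \<nu> \<rho> = (SUP A\<in>sets \<nu>. \<bar>measure \<nu> A - measure \<rho> A\<bar>)"

end

theory Submission
  imports Defs
begin

text \<open>
  The only randomness used is that, with probability tending to \<open>1\<close>, every vector \<open>u \<in> {-1,1}\<^sup>M\<close> occurs
  at least \<open>n \<approx> k / 2\<^sup>M\<^sup>+\<^sup>1\<close> times among the first \<open>k\<close> patterns; the rest is deterministic.
  Let \<open>I\<close> consist of \<open>n\<close> indices \<open>i \<le> k\<close> with pattern \<open>u\<close>. The density of the Gibbs marginal on \<open>I\<close> with
  respect to the uniform measure is an even convex function \<open>F\<close> of \<open>T = \<Sum>\<^sub>i\<^sub>\<in>\<^sub>I \<sigma>\<^sub>i\<close>. If \<open>F 0 \<le> 1 - 3 \<kappa>\<close>, then for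
  every \<open>m\<close> either \<open>F \<ge> 1 + \<kappa>\<close> on \<open>\<bar>T\<bar> \<ge> m\<close>, or \<open>F \<le> 1 - \<kappa>\<close> on \<open>\<bar>T\<bar> \<le> m/2\<close>, and for the median \<open>m\<close> of
  \<open>\<bar>T\<bar>\<close> both events have probability at least \<open>1/6\<close>.

  By the Hubbard--Stratonovich transformation \<open>F 0\<close> is the mean of \<open>cosh (g \<bullet> u / \<surd>N)\<^sup>-\<^sup>n\<close> when \<open>g\<close> has density
  proportional to \<open>q g = exp (- \<parallel>g\<parallel>\<^sup>2/2) \<Prod>\<^sub>i cosh (g \<bullet> \<xi>\<^sub>i / \<surd>N)\<close>, so it suffices that \<open>g\<close> is not concentrated
  on a cube of side of order \<open>N\<^sup>1\<^sup>/\<^sup>4\<close>. Up to a bounded factor \<open>q\<close> is there the exponential of a quadratic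
  form \<open>z\<close> without diagonal terms. Hence \<open>z\<close> has integral \<open>0\<close> over the cube, and integrating
  \<open>exp (4 z) \<ge> exp z + 3 z\<close> shows that doubling the cube increases its mass by a factor bounded away from \<open>1\<close>,
  uniformly in the patterns.
\<close>

section \<open>Sums of signs\<close>

abbreviation signs :: "'i set \<Rightarrow> ('i \<Rightarrow> real) set" where
  "signs I \<equiv> I \<rightarrow>\<^sub>E {-1, 1}"

lemma finite_signs: "finite I \<Longrightarrow> finite (signs I)"
  by (intro finite_PiE) auto

lemma card_signs: "finite I \<Longrightarrow> card (signs I) = 2 ^ card I"
  by (simp add: card_PiE numeral_2_eq_2)

text \<open>Configurations on a disjoint union are glued from their two parts by
  \<open>merge\<close>; this is how the spins outside a block are summed out later.\<close>

lemma sum_signs_Un: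
  assumes "I \<inter> J = {}"
  shows "(\<Sum>\<sigma>\<in>signs (I \<union> J). f \<sigma>) = (\<Sum>\<tau>\<in>signs I. \<Sum>\<rho>\<in>signs J. f (merge I J (\<tau>, \<rho>)))"
proof -
  have "(\<Sum>\<tau>\<in>signs I. \<Sum>\<rho>\<in>signs J. f (merge I J (\<tau>, \<rho>)))
      = (\<Sum>p\<in>signs I \<times> signs J. f (merge I J p))"
    by (subst sum.cartesian_product) (simp add: case_prod_beta')
  also have "\<dots> = (\<Sum>\<sigma>\<in>signs (I \<union> J). f \<sigma>)"
    using assms
    by (intro sum.reindex_bij_witness[where i = "\<lambda>\<sigma>. (restrict \<sigma> I, restrict \<sigma> J)" and j = "merge I J"])
       (auto simp: PiE_iff merge_def extensional_def fun_eq_iff restrict_def | blast)+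
  finally show ?thesis ..
qed

lemma sum_signs_uminus:
  "(\<Sum>\<sigma>\<in>signs I. f (\<lambda>i\<in>I. - \<sigma> i)) = (\<Sum>\<sigma>\<in>signs I. f \<sigma>)"
  by (intro sum.reindex_bij_witness[where i = "\<lambda>\<sigma>. \<lambda>i\<in>I. - \<sigma> i" and j = "\<lambda>\<sigma>. \<lambda>i\<in>I. - \<sigma> i"])
     (auto simp: PiE_iff extensional_def fun_eq_iff restrict_def minus_equation_iff)

text \<open>The exponential factorises over sites, so the sum over configurations becomes a product
  of one-site sums. Read from right to left, it expands a product of \<open>cosh\<close> over
  spins.\<close>

lemma sum_signs_exp:
  assumes "finite I"
  shows "(\<Sum>\<sigma>\<in>signs I. exp (\<Sum>i\<in>I. \<sigma> i * y i)) = (\<Prod>i\<in>I. 2 * cosh (y i))"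
proof -
  have "(\<Sum>\<sigma>\<in>signs I. exp (\<Sum>i\<in>I. \<sigma> i * y i)) = (\<Sum>\<sigma>\<in>signs I. \<Prod>i\<in>I. exp (\<sigma> i * y i))"
    using assms by (simp add: exp_sum)
  also have "\<dots> = (\<Prod>i\<in>I. \<Sum>s\<in>{-1, 1}. exp (s * y i))"
    using assms by (subst prod_sum_PiE) auto
  also have "\<dots> = (\<Prod>i\<in>I. 2 * cosh (y i))"
    by (intro prod.cong) (auto simp: cosh_field_def)
  finally show ?thesis .
qed

section \<open>Distribution of a sum of signs: binomial counts and quantiles\<close>

lemma sum_signs_eq:
  assumes "finite I" "\<tau> \<in> signs I"
  shows "(\<Sum>i\<in>I. \<tau> i) = 2 * real (card {i \<in> I. \<tau> i = 1}) - real (card I)"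
proof -
  have "(\<Sum>i\<in>I. \<tau> i) = (\<Sum>i\<in>I. 2 * of_bool (\<tau> i = 1) - 1)"
    using assms by (intro sum.cong) (auto simp: PiE_iff)
  also have "\<dots> = 2 * real (card {i \<in> I. \<tau> i = 1}) - real (card I)"
    using assms by (simp add: sum_subtractf sum_distrib_left[symmetric] Int_def conj_commute)
  finally show ?thesis .
qed

text \<open>A configuration is determined by its set of plus sites, and the prescribed sum says
  exactly that this set has \<open>j\<close> elements.\<close>

lemma card_signs_sum_eq:
  assumes "finite I"
  shows "card {\<tau> \<in> signs I. (\<Sum>i\<in>I. \<tau> i) = 2 * real j - real (card I)} = card I choose j"
proof -
  note sum_eq = sum_signs_eq[OF assms]
  have "card {\<tau> \<in> signs I. (\<Sum>i\<in>I. \<tau> i) = 2 * real j - real (card I)}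
      = card {B. B \<subseteq> I \<and> card B = j}"
  proof (rule bij_betw_same_card)
    show "bij_betw (\<lambda>\<tau>. {i \<in> I. \<tau> i = 1})
        {\<tau> \<in> signs I. (\<Sum>i\<in>I. \<tau> i) = 2 * real j - real (card I)} {B. B \<subseteq> I \<and> card B = j}"
    proof (rule bij_betw_byWitness[where f' = "\<lambda>B. \<lambda>i\<in>I. if i \<in> B then 1 else -1"])
      show "\<forall>\<tau>\<in>{\<tau> \<in> signs I. (\<Sum>i\<in>I. \<tau> i) = 2 * real j - real (card I)}.
          (\<lambda>i\<in>I. if i \<in> {i \<in> I. \<tau> i = 1} then 1 else -1) = \<tau>"
        by (auto simp: PiE_iff extensional_def fun_eq_iff)
      show "\<forall>B\<in>{B. B \<subseteq> I \<and> card B = j}. {i \<in> I. (\<lambda>i\<in>I. if i \<in> B then 1 else - 1) i = (1::real)} = B"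
        by auto
      show "(\<lambda>\<tau>. {i \<in> I. \<tau> i = 1}) ` {\<tau> \<in> signs I. (\<Sum>i\<in>I. \<tau> i) = 2 * real j - real (card I)}
          \<subseteq> {B. B \<subseteq> I \<and> card B = j}"
        using sum_eq by auto
      have *: "{i \<in> I. (\<lambda>i\<in>I. if i \<in> B then 1 else - 1) i = (1::real)} = B" if "B \<subseteq> I" for B
        using that by auto
      show "(\<lambda>B. \<lambda>i\<in>I. if i \<in> B then 1 else - 1) ` {B. B \<subseteq> I \<and> card B = j}
          \<subseteq> {\<tau> \<in> signs I. (\<Sum>i\<in>I. \<tau> i) = 2 * real j - real (card I)}"
      proof safe
        fix B assume "B \<subseteq> I" "j = card B"
        moreover have mem: "(\<lambda>i\<in>I. if i \<in> B then 1 else - 1) \<in> signs I"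
          by auto
        ultimately show "(\<Sum>i\<in>I. (\<lambda>i\<in>I. if i \<in> B then 1 else - 1) i) = 2 * real (card B) - real (card I)"
          using sum_eq[OF mem] *[of B] by simp
      qed (auto split: if_splits)
    qed
  qed
  also have "\<dots> = card I choose j"
    using assms by (rule n_subsets)
  finally show ?thesis .
qed

text \<open>With \<open>2 * h\<close> sites the sum is \<open>2 * (j - h)\<close>, where
  \<open>j\<close> counts the plus sites, so the condition selects the \<open>j\<close> within
  distance \<open>L\<close> of \<open>h\<close>. Symmetry of the binomial coefficients folds the two
  sides together.\<close>

lemma card_signs_abs_sum_le:
  assumes "finite I" "card I = 2 * h" "L \<le> h"
  shows "card {\<tau> \<in> signs I. \<bar>\<Sum>i\<in>I. \<tau> i\<bar> \<le> 2 * real L}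
      = (2 * h choose h) + 2 * (\<Sum>l=1..L. 2 * h choose (h + l))"
proof -
  let ?T = "\<lambda>\<tau>. \<Sum>i\<in>I. \<tau> i"
  have T: "\<exists>j. j \<le> 2 * h \<and> ?T \<tau> = 2 * real j - real (card I)" if "\<tau> \<in> signs I" for \<tau>
  proof (intro exI conjI)
    show "card {i \<in> I. \<tau> i = 1} \<le> 2 * h"
      using assms by (metis (no_types, lifting) card_mono mem_Collect_eq subsetI)
    show "(\<Sum>i\<in>I. \<tau> i) = 2 * real (card {i \<in> I. \<tau> i = 1}) - real (card I)"
      using assms(1) that by (rule sum_signs_eq)
  qed
  have "{\<tau> \<in> signs I. \<bar>?T \<tau>\<bar> \<le> 2 * real L}
      = (\<Union>j\<in>{h - L..h + L}. {\<tau> \<in> signs I. ?T \<tau> = 2 * real j - real (card I)})"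
    (is "?lhs = ?rhs")
  proof
    show "?lhs \<subseteq> ?rhs"
    proof
      fix \<tau> assume "\<tau> \<in> ?lhs"
      with T[of \<tau>] obtain j where "\<tau> \<in> signs I" "?T \<tau> = 2 * real j - real (card I)"
        "\<bar>?T \<tau>\<bar> \<le> 2 * real L" by auto
      moreover from this have "j \<in> {h - L..h + L}"
        using assms by auto
      ultimately show "\<tau> \<in> ?rhs" by blast
    qed
    show "?rhs \<subseteq> ?lhs"
      using assms by (auto simp: abs_le_iff)
  qed
  also have "card \<dots> = (\<Sum>j\<in>{h - L..h + L}. 2 * h choose j)"
    using assms finite_signs[of I] card_signs_sum_eq[of I]
    by (subst card_UN_disjoint) auto
  \<comment> \<open>The centre is split from the two wings. Since \<open>L \<le> h\<close>, the
    natural subtraction \<open>h - l\<close> never truncates, so both wings are injective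
    images.\<close>
  also have "{h - L..h + L} = (\<lambda>l. h - l) ` {1..L} \<union> {h} \<union> (\<lambda>l. h + l) ` {1..L}"
    (is "?A = ?B")
  proof (intro equalityI subsetI)
    fix j assume j: "j \<in> ?A"
    consider "j = h" | "j < h" "j = h - (h - j)" | "j > h" "j = h + (j - h)" by linarith
    then show "j \<in> ?B"
    proof cases
      case 2
      then show ?thesis using j assms by (intro UnI1 image_eqI[where x = "h - j"]) auto
    next
      case 3
      then show ?thesis using j assms by (intro UnI2 image_eqI[where x = "j - h"]) auto
    qed simp
  qed (use assms in auto)
  also have "(\<Sum>j\<in>\<dots>. 2 * h choose j)
      = (\<Sum>l=1..L. 2 * h choose (h - l)) + (2 * h choose h) + (\<Sum>l=1..L. 2 * h choose (h + l))"
  proof -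
    have "inj_on (\<lambda>l. h - l) {1..L}" "inj_on (\<lambda>l. h + l) {1..L}"
      using assms by (auto simp: inj_on_def)
    then have "(\<Sum>j\<in>(\<lambda>l. h - l) ` {1..L}. 2 * h choose j) = (\<Sum>l=1..L. 2 * h choose (h - l))"
      "(\<Sum>j\<in>(\<lambda>l. h + l) ` {1..L}. 2 * h choose j) = (\<Sum>l=1..L. 2 * h choose (h + l))"
      by (simp_all only: sum.reindex o_def)
    moreover have "((\<lambda>l. h - l) ` {1..L} \<union> {h}) \<inter> (\<lambda>l. h + l) ` {1..L} = {}"
      "(\<lambda>l. h - l) ` {1..L} \<inter> {h} = {}"
      using assms by auto
    ultimately show ?thesis
      by (simp only: sum.union_disjoint finite_imageI finite_atLeastAtMost finite.intros finite_Un simp_thms)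
        simp
  qed
  also have "(\<Sum>l=1..L. 2 * h choose (h - l)) = (\<Sum>l=1..L. 2 * h choose (h + l))"
    using assms by (intro sum.cong refl, subst binomial_symmetric) (auto simp: mult_2)
  finally show ?thesis by simp
qed

text \<open>Raising \<open>L\<close> by two adds two terms on the left and one new term on the
  right; by monotonicity each of the two is at most the new one. The summand \<open>c 0\<close> pays
  for the case \<open>L = 1\<close>.\<close>

lemma sum_le_twice_sum_half:
  fixes c :: "nat \<Rightarrow> nat"
  assumes "\<And>i j. i \<le> j \<Longrightarrow> j \<le> h \<Longrightarrow> c j \<le> c i" "L \<le> h"
  shows "(\<Sum>l=1..L. c l) \<le> c 0 + 2 * (\<Sum>l=1..L div 2. c l)"
  using assms(2)
proof (induction L rule: nat_less_induct)
  case (1 L)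
  consider "L = 0" | "L = 1" | K where "L = Suc (Suc K)"
    by (metis One_nat_def not0_implies_Suc)
  then show ?case
  proof cases
    case 3
    have "c (Suc K) \<le> c (Suc (K div 2))" "c (Suc (Suc K)) \<le> c (Suc (K div 2))"
      using 1 3 by (auto intro!: assms(1))
    moreover have "(\<Sum>l=1..K. c l) \<le> c 0 + 2 * (\<Sum>l=1..K div 2. c l)"
      using 1 3 by auto
    ultimately show ?thesis using 3 by simp
  qed (use 1 assms(1)[of 0 1] in auto)
qed

text \<open>Take \<open>m\<close> to be a median of the absolute sum, so that each side of it
  carries at least half of the configurations. Unimodality of the binomial coefficients shows that
  halving the central window costs at most a factor 3, and 1/2 divided by 3 is 1/6.\<close>

lemma rademacher_sum_quantile:
  assumes "finite I" "even (card I)"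
  obtains m where "m \<ge> 0"
    "real (card {\<tau> \<in> signs I. m \<le> \<bar>\<Sum>i\<in>I. \<tau> i\<bar>}) \<ge> 2 ^ card I / 6"
    "real (card {\<tau> \<in> signs I. \<bar>\<Sum>i\<in>I. \<tau> i\<bar> \<le> m / 2}) \<ge> 2 ^ card I / 6"
proof -
  from assms obtain h where h: "card I = 2 * h" by (auto elim: evenE)
  define ge where "ge = (\<lambda>L. card {\<tau> \<in> signs I. 2 * real L \<le> \<bar>\<Sum>i\<in>I. \<tau> i\<bar>})"
  define le where "le = (\<lambda>L. card {\<tau> \<in> signs I. \<bar>\<Sum>i\<in>I. \<tau> i\<bar> \<le> 2 * real L})"
  have fin: "finite (signs I)" using assms finite_signs by auto
  have bound: "\<bar>\<Sum>i\<in>I. \<tau> i\<bar> \<le> 2 * real h" if "\<tau> \<in> signs I" for \<tau>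
  proof -
    have "\<bar>\<Sum>i\<in>I. \<tau> i\<bar> \<le> (\<Sum>i\<in>I. \<bar>\<tau> i\<bar>)" by (rule sum_abs)
    also have "\<dots> = (\<Sum>i\<in>I. 1)" using that by (intro sum.cong) (auto simp: PiE_iff)
    finally show ?thesis using h by simp
  qed
  \<comment> \<open>The largest level whose upper tail still holds half of the configurations. By
    maximality the tail one level higher holds less than half, so the central window up to
    \<open>2 * L\<close> holds at least half.\<close>
  define L where "L = Max {L \<in> {0..h}. 2 ^ card I \<le> 2 * ge L}"
  have "0 \<in> {L \<in> {0..h}. 2 ^ card I \<le> 2 * ge L}"
    by (auto simp: ge_def card_signs assms(1))
  then have "L \<in> {L \<in> {0..h}. 2 ^ card I \<le> 2 * ge L}"
    unfolding L_def by (intro Max_in) auto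
  then have L: "L \<le> h" "2 ^ card I \<le> 2 * ge L" by auto
  have "2 ^ card I \<le> 2 * le L"
  proof (cases "L = h")
    case True
    then have "le L = card (signs I)" unfolding le_def using bound by (intro arg_cong[where f = card]) auto
    then show ?thesis by (simp add: card_signs assms(1))
  next
    case False
    have "Suc L \<notin> {L \<in> {0..h}. 2 ^ card I \<le> 2 * ge L}"
    proof
      assume "Suc L \<in> {L \<in> {0..h}. 2 ^ card I \<le> 2 * ge L}"
      then have "Suc L \<le> L" unfolding L_def by (intro Max_ge) auto
      then show False by simp
    qed
    moreover have "Suc L \<in> {0..h}" using False L(1) by simp
    ultimately have "2 * ge (Suc L) < 2 ^ card I" unfolding mem_Collect_eq by linarith
    moreover have "2 ^ card I \<le> le L + ge (Suc L)"
    proof -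
      have "signs I \<subseteq> {\<tau> \<in> signs I. \<bar>\<Sum>i\<in>I. \<tau> i\<bar> \<le> 2 * real L}
          \<union> {\<tau> \<in> signs I. 2 * real (Suc L) \<le> \<bar>\<Sum>i\<in>I. \<tau> i\<bar>}"
      proof
        fix \<tau> assume \<tau>: "\<tau> \<in> signs I"
        define c where "c = card {i \<in> I. \<tau> i = 1}"
        have T: "(\<Sum>i\<in>I. \<tau> i) = 2 * real c - 2 * real h"
          using sum_signs_eq[OF assms(1) \<tau>] h by (simp add: c_def)
        \<comment> \<open>Half of the absolute sum is the integer \<open>z\<close>: no value lies
          strictly between \<open>2 * L\<close> and \<open>2 * Suc L\<close>, so the two events
          cover everything. This uses that \<open>card I\<close> is even.\<close>
        define z where "z = \<bar>int c - int h\<bar>"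
        have z: "\<bar>\<Sum>i\<in>I. \<tau> i\<bar> = 2 * real_of_int z"
          unfolding T z_def of_int_abs of_int_diff of_int_of_nat_eq by (auto simp: abs_if)
        consider "z \<le> int L" | "int (Suc L) \<le> z"
          by linarith
        then have "\<bar>\<Sum>i\<in>I. \<tau> i\<bar> \<le> 2 * real L \<or> 2 * real (Suc L) \<le> \<bar>\<Sum>i\<in>I. \<tau> i\<bar>"
        proof cases
          case 1
          then have "real_of_int z \<le> real L" by linarith
          then show ?thesis unfolding z by (intro disjI1 mult_left_mono zero_le_numeral)
        next
          case 2
          then have "real (Suc L) \<le> real_of_int z" by linarith
          then show ?thesis unfolding z by (intro disjI2 mult_left_mono zero_le_numeral)
        qed
        then show "\<tau> \<in> {\<tau> \<in> signs I. \<bar>\<Sum>i\<in>I. \<tau> i\<bar> \<le> 2 * real L}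
          \<union> {\<tau> \<in> signs I. 2 * real (Suc L) \<le> \<bar>\<Sum>i\<in>I. \<tau> i\<bar>}"
          using \<tau> by blast
      qed
      then have "card (signs I) \<le> card ({\<tau> \<in> signs I. \<bar>\<Sum>i\<in>I. \<tau> i\<bar> \<le> 2 * real L}
          \<union> {\<tau> \<in> signs I. 2 * real (Suc L) \<le> \<bar>\<Sum>i\<in>I. \<tau> i\<bar>})"
        using fin by (intro card_mono) auto
      also have "\<dots> \<le> le L + ge (Suc L)"
        unfolding le_def ge_def by (rule card_Un_le)
      finally show ?thesis
        by (simp add: card_signs assms(1))
    qed
    ultimately show ?thesis by linarith
  qed
  \<comment> \<open>With centre c and half-window sum S, the left side is at most c + 2 (c + 2 S) =
    3 c + 4 S, which is at most 3 (c + 2 S).\<close>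
  moreover have "le L \<le> 3 * le (L div 2)"
  proof -
    have "(\<Sum>l=1..L. 2 * h choose (h + l))
        \<le> (2 * h choose (h + 0)) + 2 * (\<Sum>l=1..L div 2. 2 * h choose (h + l))"
      by (rule sum_le_twice_sum_half[where h = h]) (auto intro!: binomial_antimono L)
    moreover have "le L = (2 * h choose h) + 2 * (\<Sum>l=1..L. 2 * h choose (h + l))"
      unfolding le_def using L by (intro card_signs_abs_sum_le) (auto simp: assms h)
    moreover have "le (L div 2) = (2 * h choose h) + 2 * (\<Sum>l=1..L div 2. 2 * h choose (h + l))"
      unfolding le_def using L by (intro card_signs_abs_sum_le) (auto simp: assms h)
    ultimately show ?thesis by simp
  qed
  moreover have "le (L div 2) \<le> card {\<tau> \<in> signs I. \<bar>\<Sum>i\<in>I. \<tau> i\<bar> \<le> (2 * real L) / 2}"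
  proof -
    have "2 * real (L div 2) \<le> real L" using of_nat_mono[of "2 * (L div 2)" L] by simp
    then show ?thesis unfolding le_def using fin by (intro card_mono) auto
  qed
  ultimately have "2 ^ card I \<le> 6 * card {\<tau> \<in> signs I. \<bar>\<Sum>i\<in>I. \<tau> i\<bar> \<le> (2 * real L) / 2}" by linarith
  then have "real (2 ^ card I) \<le> real (6 * card {\<tau> \<in> signs I. \<bar>\<Sum>i\<in>I. \<tau> i\<bar> \<le> (2 * real L) / 2})"
    by (rule of_nat_mono)
  moreover have "real (2 ^ card I) \<le> real (2 * ge L)"
    using L(2) by (rule of_nat_mono)
  ultimately show ?thesis
    unfolding ge_def of_nat_mult of_nat_power of_nat_numeral
    by (intro that[of "2 * real L"]; linarith)
qed

section \<open>The Hubbard--Stratonovich transformation\<close>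

lemma integral_lborel_pos:
  fixes f :: "'a::euclidean_space \<Rightarrow> real"
  assumes "integrable lborel f" "\<And>x. 0 < f x"
  shows "0 < integral\<^sup>L lborel f"
proof -
  have "integral\<^sup>L lborel f \<noteq> 0"
  proof
    assume "integral\<^sup>L lborel f = 0"
    then have "AE x in lborel. f x = 0"
      using assms by (subst (asm) integral_nonneg_eq_0_iff_AE) (auto simp: less_imp_le)
    then have "AE x::'a in lborel. False"
      by eventually_elim (use assms(2) in \<open>metis less_irrefl\<close>)
    then show False
      by (simp add: AE_iff_measurable[OF _ refl])
  qed
  then show ?thesis
    using assms by (simp add: less_le integral_nonneg_AE)
qed

lemma integral_lborel_translate:
  fixes f :: "'a::euclidean_space \<Rightarrow> real"
  assumes [measurable]: "f \<in> borel_measurable borel"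
  shows "(\<integral>x. f (v + x) \<partial>lborel) = integral\<^sup>L lborel f"
    and "integrable lborel (\<lambda>x. f (v + x)) \<longleftrightarrow> integrable lborel f"
proof -
  have "integral\<^sup>L (distr lborel borel ((+) v)) f = (\<integral>x. f (v + x) \<partial>lborel)"
    by (subst integral_distr) auto
  then show "(\<integral>x. f (v + x) \<partial>lborel) = integral\<^sup>L lborel f"
    by (simp add: lborel_distr_plus)
  have "integrable (distr lborel borel ((+) v)) f \<longleftrightarrow> integrable lborel (\<lambda>x. f (v + x))"
    by (subst integrable_distr_eq) auto
  then show "integrable lborel (\<lambda>x. f (v + x)) \<longleftrightarrow> integrable lborel f"
    by (simp add: lborel_distr_plus)
qed

text \<open>The standard Gaussian density without its normalising constant, which is never computed:
  it appears on both sides of every comparison and cancels.\<close>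

definition gauss :: "'a::euclidean_space \<Rightarrow> real" where
  "gauss g = exp (- (norm g)\<^sup>2 / 2)"

lemma borel_measurable_gauss [measurable]: "gauss \<in> borel_measurable borel"
  unfolding gauss_def[abs_def] by measurable

lemma gauss_pos: "0 < gauss g"
  by (simp add: gauss_def)

lemma integrable_gauss: "integrable lborel (gauss :: 'a::euclidean_space \<Rightarrow> real)"
proof (rule integrableI_bounded)
  have norm_sq: "(norm g)\<^sup>2 = (\<Sum>b\<in>Basis. (g \<bullet> b)\<^sup>2)" for g :: 'a
    unfolding power2_norm_eq_inner by (subst euclidean_inner) (simp add: power2_eq_square)
  have "(\<integral>\<^sup>+g. ennreal (norm (gauss (g::'a))) \<partial>lborel)
      = (\<integral>\<^sup>+g. (\<Prod>b\<in>Basis. ennreal (exp (- (g \<bullet> b)\<^sup>2 / 2))) \<partial>(lborel :: 'a measure))"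
    unfolding gauss_def norm_sq
    by (intro nn_integral_cong)
       (simp add: prod_ennreal exp_sum[symmetric] sum_negf sum_divide_distrib[symmetric])
  also have "\<dots> = (\<Prod>b\<in>(Basis :: 'a set). \<integral>\<^sup>+x. ennreal (exp (- x\<^sup>2 / 2)) \<partial>lborel)"
    by (subst nn_integral_lborel_prod) auto
  also have "(\<integral>\<^sup>+x. ennreal (exp (- x\<^sup>2 / 2)) \<partial>lborel) < \<infinity>"
  proof -
    have "integrable lborel (\<lambda>x. sqrt (2 * pi) * std_normal_density x)"
      by auto
    also have "(\<lambda>x. sqrt (2 * pi) * std_normal_density x) = (\<lambda>x. exp (- x\<^sup>2 / 2))"
      by (simp add: std_normal_density_def fun_eq_iff)
    finally show ?thesis
      by (simp add: integrable_iff_bounded)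
  qed
  then have "(\<Prod>b\<in>(Basis :: 'a set). \<integral>\<^sup>+x. ennreal (exp (- x\<^sup>2 / 2)) \<partial>lborel) < \<infinity>"
    by (simp add: power_less_top_ennreal)
  finally show "(\<integral>\<^sup>+g. ennreal (norm (gauss (g::'a))) \<partial>lborel) < \<infinity>" .
qed simp

text \<open>Completing the square turns the integrand into a constant times the Gaussian translated
  by \<open>v\<close>.\<close>

lemma gauss_exp_inner:
  fixes v :: "'a::euclidean_space"
  shows "integrable lborel (\<lambda>g. gauss g * exp (g \<bullet> v))"
    and "(\<integral>g. gauss g * exp (g \<bullet> v) \<partial>lborel)
      = exp ((norm v)\<^sup>2 / 2) * integral\<^sup>L lborel (gauss :: 'a \<Rightarrow> real)"
proof -
  have eq: "gauss g * exp (g \<bullet> v) = exp ((norm v)\<^sup>2 / 2) * gauss (- v + g)" for g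
    unfolding gauss_def exp_add[symmetric] power2_norm_eq_inner
    by (simp add: algebra_simps inner_commute diff_divide_distrib add_divide_distrib)
  show "integrable lborel (\<lambda>g. gauss g * exp (g \<bullet> v))"
    unfolding eq using integral_lborel_translate(2)[of gauss "- v"] integrable_gauss
    by (intro integrable_mult_right) simp
  show "(\<integral>g. gauss g * exp (g \<bullet> v) \<partial>lborel)
      = exp ((norm v)\<^sup>2 / 2) * integral\<^sup>L lborel (gauss :: 'a \<Rightarrow> real)"
    unfolding eq integral_mult_right_zero using integral_lborel_translate(1)[of gauss "- v"] by simp
qed

text \<open>Expanding the product of \<open>cosh\<close> over spins gives a finite sum of Gaussian
  exponential moments, each of which is the exponential of half a squared norm. The index set
  \<open>S\<close> is arbitrary because both the full system and the complement of a block are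
  needed.\<close>

lemma hubbard_stratonovich:
  fixes x :: "'i \<Rightarrow> 'a::euclidean_space"
  assumes "finite S" "N > 0"
  shows "integrable lborel (\<lambda>g. gauss g * (\<Prod>i\<in>S. 2 * cosh (g \<bullet> x i / sqrt N)))"
    and "(\<integral>g. gauss g * (\<Prod>i\<in>S. 2 * cosh (g \<bullet> x i / sqrt N)) \<partial>lborel)
      = integral\<^sup>L lborel (gauss :: 'a \<Rightarrow> real)
        * (\<Sum>\<sigma>\<in>signs S. exp ((norm (\<Sum>i\<in>S. \<sigma> i *\<^sub>R x i))\<^sup>2 / (2 * N)))"
proof -
  define v where "v = (\<lambda>\<sigma>. (1 / sqrt N) *\<^sub>R (\<Sum>i\<in>S. \<sigma> i *\<^sub>R x i))"
  have eq: "gauss g * (\<Prod>i\<in>S. 2 * cosh (g \<bullet> x i / sqrt N)) = (\<Sum>\<sigma>\<in>signs S. gauss g * exp (g \<bullet> v \<sigma>))" for g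
    using assms
    by (simp add: sum_signs_exp[symmetric] sum_distrib_left v_def inner_sum_right sum_divide_distrib)
  show "integrable lborel (\<lambda>g. gauss g * (\<Prod>i\<in>S. 2 * cosh (g \<bullet> x i / sqrt N)))"
    unfolding eq by (intro Bochner_Integration.integrable_sum gauss_exp_inner)
  have norm_v: "(norm (v \<sigma>))\<^sup>2 / 2 = (norm (\<Sum>i\<in>S. \<sigma> i *\<^sub>R x i))\<^sup>2 / (2 * N)" for \<sigma>
    using assms by (simp add: v_def power_divide)
  show "(\<integral>g. gauss g * (\<Prod>i\<in>S. 2 * cosh (g \<bullet> x i / sqrt N)) \<partial>lborel)
      = integral\<^sup>L lborel (gauss :: 'a \<Rightarrow> real)
        * (\<Sum>\<sigma>\<in>signs S. exp ((norm (\<Sum>i\<in>S. \<sigma> i *\<^sub>R x i))\<^sup>2 / (2 * N)))"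
    unfolding eq
    by (subst Bochner_Integration.integral_sum, rule gauss_exp_inner)
       (simp add: gauss_exp_inner norm_v sum_distrib_left mult.commute)
qed

section \<open>The field measure near the origin\<close>

lemma one_plus_half_square_le_cosh: "1 + y\<^sup>2 / 2 \<le> cosh (y::real)"
proof -
  \<comment> \<open>The power series has only even, hence nonnegative, terms, so truncating it
    lowers the value.\<close>
  have "(\<Sum>n<3. if even n then y ^ n /\<^sub>R fact n else 0) \<le> (\<Sum>n. if even n then y ^ n /\<^sub>R fact n else 0)"
    using sums_summable[OF cosh_converges[of y]]
    by (intro sum_le_suminf) (auto simp: zero_le_even_power)
  also have "\<dots> = cosh y"
    using cosh_converges[of y] by (rule sums_unique[symmetric])
  also have "(\<Sum>n<3. if even n then y ^ n /\<^sub>R fact n else 0) = 1 + y\<^sup>2 / 2"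
    by (simp add: numeral_3_eq_3 lessThan_Suc fact_numeral power2_eq_square)
  finally show ?thesis .
qed

text \<open>Apply ln (1 + t) >= t - t^2 on [0, 1] with t = y^2 / 2 to the truncated series; the
  square of t is the quartic error.\<close>

lemma exp_le_cosh:
  assumes "\<bar>y\<bar> \<le> 1"
  shows "exp (y\<^sup>2 / 2 - y ^ 4 / 4) \<le> cosh (y::real)"
proof -
  have "y\<^sup>2 / 2 \<le> 1"
    using power_mono[OF assms, of 2] by simp
  then have "y\<^sup>2 / 2 - (y\<^sup>2 / 2)\<^sup>2 \<le> ln (1 + y\<^sup>2 / 2)"
    by (intro ln_one_plus_pos_lower_bound) auto
  then have "y\<^sup>2 / 2 - y ^ 4 / 4 \<le> ln (1 + y\<^sup>2 / 2)"
    by (simp add: power_divide flip: power_mult)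
  then have "exp (y\<^sup>2 / 2 - y ^ 4 / 4) \<le> exp (ln (1 + y\<^sup>2 / 2))"
    by simp
  also have "\<dots> = 1 + y\<^sup>2 / 2"
    by (rule exp_ln) (simp add: add_pos_nonneg)
  finally show ?thesis
    using one_plus_half_square_le_cosh[of y] by simp
qed

lemma borel_measurable_cosh [measurable]: "cosh \<in> borel_measurable (borel :: real measure)"
  by (intro borel_measurable_continuous_onI continuous_intros)

text \<open>For nonnegative \<open>y\<close>, the difference of the logarithms has derivative y -
  tanh y, which is nonnegative because its own derivative is the square of tanh. Evenness covers
  negative \<open>y\<close>.\<close>

lemma cosh_le_exp_half_square: "cosh y \<le> exp (y\<^sup>2 / 2)" for y :: real
proof -
  have tanh_le: "tanh y \<le> y" if "0 \<le> y" for y :: real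
  proof -
    have "0 - tanh 0 \<le> y - tanh y"
    proof (rule DERIV_nonneg_imp_nondecreasing[OF that])
      fix z :: real
      have "((\<lambda>z. z - tanh z) has_real_derivative (tanh z)\<^sup>2) (at z)"
        by (rule derivative_eq_intros refl | simp)+
      then show "\<exists>d. ((\<lambda>z. z - tanh z) has_real_derivative d) (at z) \<and> 0 \<le> d"
        by (intro exI conjI) auto
    qed
    then show ?thesis by simp
  qed
  have nonneg: "cosh y \<le> exp (y\<^sup>2 / 2)" if "0 \<le> y" for y :: real
  proof -
    have "0\<^sup>2 / 2 - ln (cosh 0) \<le> y\<^sup>2 / 2 - ln (cosh y)"
    proof (rule DERIV_nonneg_imp_nondecreasing[OF that])
      fix z :: real assume "0 \<le> z"
      have "((\<lambda>z. z\<^sup>2 / 2 - ln (cosh z)) has_real_derivative z - tanh z) (at z)"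
        by (rule derivative_eq_intros refl | simp add: tanh_def)+
      then show "\<exists>d. ((\<lambda>z. z\<^sup>2 / 2 - ln (cosh z)) has_real_derivative d) (at z) \<and> 0 \<le> d"
        using tanh_le[OF \<open>0 \<le> z\<close>] by (intro exI conjI) auto
    qed
    then have "ln (cosh y) \<le> y\<^sup>2 / 2" by simp
    then have "exp (ln (cosh y)) \<le> exp (y\<^sup>2 / 2)" by (simp only: exp_le_cancel_iff)
    also have "exp (ln (cosh y)) = cosh y" by (rule exp_ln) simp
    finally show ?thesis .
  qed
  show ?thesis
    using nonneg[of "\<bar>y\<bar>"] by (simp add: cosh_real_abs)
qed

section \<open>Dilation and reflection of Lebesgue measure\<close>

lemma integral_lborel_scale:
  fixes f :: "'a::euclidean_space \<Rightarrow> real"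
  assumes [measurable]: "f \<in> borel_measurable borel" and "c > 0"
  shows "integral\<^sup>L lborel f = c ^ DIM('a) * (\<integral>x. f (c *\<^sub>R x) \<partial>lborel)"
proof -
  have "integral\<^sup>L lborel f
      = integral\<^sup>L (density (distr lborel borel (\<lambda>x. 0 + c *\<^sub>R x)) (\<lambda>_. \<bar>c\<bar> ^ DIM('a))) f"
    using lborel_affine[of c "0::'a"] assms by simp
  also have "\<dots> = c ^ DIM('a) * (\<integral>x. f (c *\<^sub>R x) \<partial>lborel)"
    using assms by (subst integral_real_density) (auto simp: integral_distr)
  finally show ?thesis .
qed

text \<open>Reflecting one coordinate preserves Lebesgue measure, so the integral equals its own
  negative.\<close>

lemma integral_lborel_odd_coordinate:
  fixes f :: "real ^ 'm \<Rightarrow> real"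
  assumes [measurable]: "f \<in> borel_measurable borel"
    and odd: "\<And>g. f (\<chi> \<mu>. if \<mu> = \<nu> then - g $ \<mu> else g $ \<mu>) = - f g"
  shows "integral\<^sup>L lborel f = 0"
proof -
  \<comment> \<open>The reflection is encoded as a diagonal scaling, the form that
    \<open>lborel_affine_euclidean\<close> handles; the coefficients have modulus 1, so the Jacobian
    density is 1.\<close>
  define c :: "real ^ 'm \<Rightarrow> real" where "c = (\<lambda>b. if b = axis \<nu> 1 then -1 else 1)"
  define R where "R = (\<lambda>g :: real ^ 'm. 0 + (\<Sum>b\<in>Basis. (c b * (g \<bullet> b)) *\<^sub>R b))"
  have R: "R g = (\<chi> \<mu>. if \<mu> = \<nu> then - g $ \<mu> else g $ \<mu>)" for g
  proof (rule vec_eq_iff[THEN iffD2], rule allI)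
    fix \<mu> :: 'm
    have axis_nth: "axis \<kappa> (1 :: real) $ \<mu> = (if \<kappa> = \<mu> then 1 else 0)" for \<kappa>
      by (simp add: axis_def)
    have Basis: "Basis = range (\<lambda>\<kappa>. axis \<kappa> (1 :: real) :: real ^ 'm)"
      by (auto simp: Basis_vec_def)
    have "R g $ \<mu> = (\<Sum>\<kappa>\<in>UNIV. c (axis \<kappa> 1) * (g \<bullet> axis \<kappa> 1) * axis \<kappa> 1 $ \<mu>)"
      unfolding R_def Basis by (simp add: sum.reindex inj_on_def axis_eq_axis)
    also have "\<dots> = c (axis \<mu> 1) * g $ \<mu>"
      by (simp add: inner_axis axis_nth if_distrib cong: if_cong)
    finally show "R g $ \<mu> = (\<chi> \<mu>. if \<mu> = \<nu> then - g $ \<mu> else g $ \<mu>) $ \<mu>"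
      by (simp add: c_def axis_eq_axis)
  qed
  have [measurable]: "R \<in> borel_measurable borel"
    unfolding R_def by measurable
  have "(\<Prod>b\<in>Basis. \<bar>c b\<bar>) = 1"
    by (intro prod.neutral) (simp add: c_def)
  then have "lborel = distr lborel borel R"
    using lborel_affine_euclidean[of c 0] unfolding R_def
    by (simp add: c_def density_1 prod_ennreal[symmetric])
  then have "integral\<^sup>L lborel f = integral\<^sup>L (distr lborel borel R) f"
    by simp
  also have "\<dots> = (\<integral>g. f (R g) \<partial>lborel)"
    by (rule integral_distr) auto
  also have "\<dots> = - integral\<^sup>L lborel f"
    unfolding R odd by simp
  finally show ?thesis by simp
qed

text \<open>One fixed realisation of the patterns. All estimates in this context are deterministic,
  with constants that do not depend on the realisation.\<close>

locale sign_patterns =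
  fixes N :: nat and x :: "nat \<Rightarrow> real ^ 'm"
  assumes N_pos: "0 < N"
    and pm: "\<And>i \<nu>. i \<in> {1..N} \<Longrightarrow> x i $ \<nu> \<in> {-1, 1}"
begin

definition field_weight :: "real ^ 'm \<Rightarrow> real" where
  "field_weight g = gauss g * (\<Prod>i=1..N. cosh (g \<bullet> x i / sqrt N))"

text \<open>The second-order part of the logarithm of \<open>field_weight\<close>: every ln (cosh y)
  is replaced by y^2 / 2.\<close>

definition quad :: "real ^ 'm \<Rightarrow> real" where
  "quad g = (\<Sum>i=1..N. (g \<bullet> x i)\<^sup>2) / (2 * N) - (norm g)\<^sup>2 / 2"

text \<open>The scale N^(1/4) is where the quartic correction, summed over the sites, stays bounded.
  The factor \<open>2 * CARD('m)\<close> ensures that even the doubled cube satisfies the hypothesis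
  of \<open>field_weight_ge\<close>.\<close>

definition radius :: real where
  "radius = sqrt (sqrt N) / (2 * CARD('m))"

definition cube :: "(real ^ 'm) set" where
  "cube = {g. \<forall>\<nu>. \<bar>g $ \<nu>\<bar> \<le> radius}"

lemma radius_pos: "0 < radius"
  using N_pos by (simp add: radius_def)

lemma field_weight_pos: "0 < field_weight g"
  by (simp add: field_weight_def gauss_pos prod_pos)

lemma borel_measurable_field_weight [measurable]: "field_weight \<in> borel_measurable borel"
  unfolding field_weight_def[abs_def] by measurable

lemma integrable_field_weight: "integrable lborel field_weight"
proof -
  have "integrable lborel (\<lambda>g. gauss g * (\<Prod>i=1..N. 2 * cosh (g \<bullet> x i / sqrt N)))"
    using N_pos by (intro hubbard_stratonovich) auto
  then have "integrable lborel (\<lambda>g. (1 / 2 ^ N) * (gauss g * (\<Prod>i=1..N. 2 * cosh (g \<bullet> x i / sqrt N))))"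
    by (rule integrable_mult_right)
  then show ?thesis
    by (simp add: field_weight_def[abs_def] prod.distrib)
qed

lemma field_weight_le: "field_weight g \<le> exp (quad g)"
proof -
  have "(\<Prod>i=1..N. cosh (g \<bullet> x i / sqrt N)) \<le> (\<Prod>i=1..N. exp ((g \<bullet> x i / sqrt N)\<^sup>2 / 2))"
    by (intro prod_mono) (auto simp: cosh_le_exp_half_square)
  also have "\<dots> = exp ((\<Sum>i=1..N. (g \<bullet> x i)\<^sup>2) / (2 * N))"
    by (simp add: exp_sum[symmetric] power_divide sum_divide_distrib mult.commute)
  finally have "field_weight g \<le> gauss g * exp ((\<Sum>i=1..N. (g \<bullet> x i)\<^sup>2) / (2 * N))"
    unfolding field_weight_def using gauss_pos[of g] by simp
  also have "\<dots> = exp (quad g)"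
    unfolding gauss_def quad_def exp_add[symmetric] by simp
  finally show ?thesis .
qed

text \<open>If every projection is at most N^(1/4), then y = (g . x_i) / sqrt N has y^4 <= 1/N, so
  each site loses at most 1/(4 N) in the exponent and all sites together at most 1/4.\<close>

lemma field_weight_ge:
  assumes "\<And>i. i \<in> {1..N} \<Longrightarrow> \<bar>g \<bullet> x i\<bar> \<le> sqrt (sqrt N)"
  shows "exp (- 1 / 4) * exp (quad g) \<le> field_weight g"
proof -
  have le: "exp ((g \<bullet> x i)\<^sup>2 / (2 * N) - 1 / (4 * N)) \<le> cosh (g \<bullet> x i / sqrt N)" if i: "i \<in> {1..N}" for i
  proof -
    define y where "y = g \<bullet> x i / sqrt N"
    \<comment> \<open>Since N >= 1, the bound N^(1/4) is at most sqrt N; this gives the condition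
      |y| <= 1 of \<open>exp_le_cosh\<close>.\<close>
    have "sqrt (sqrt N) \<le> sqrt (sqrt N) ^ 2"
      using N_pos by (intro self_le_power) auto
    with assms[OF i] have "\<bar>g \<bullet> x i\<bar> \<le> sqrt (sqrt N) ^ 2"
      by (rule order_trans)
    then have "\<bar>g \<bullet> x i\<bar> \<le> sqrt N"
      by simp
    then have y: "\<bar>y\<bar> \<le> 1"
      using N_pos by (simp add: y_def)
    have "\<bar>g \<bullet> x i\<bar> ^ 4 \<le> sqrt (sqrt N) ^ 4"
      using assms[OF i] by (intro power_mono) auto
    also have "\<dots> = (sqrt (sqrt N) ^ 2) ^ 2"
      unfolding power_mult[symmetric] by simp
    also have "\<dots> = N"
      by (simp only: real_sqrt_pow2 real_sqrt_ge_zero of_nat_0_le_iff)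
    finally have "(g \<bullet> x i) ^ 4 \<le> N"
      by simp
    moreover have "y ^ 4 = (g \<bullet> x i) ^ 4 / (sqrt N ^ 2) ^ 2"
      unfolding power_mult[symmetric] by (simp add: y_def power_divide)
    ultimately have "y ^ 4 \<le> N / N\<^sup>2"
      by (simp add: divide_right_mono)
    then have "y ^ 4 \<le> 1 / N"
      using N_pos by (simp add: power2_eq_square)
    moreover have "y\<^sup>2 / 2 = (g \<bullet> x i)\<^sup>2 / (2 * N)"
      by (simp add: y_def power_divide)
    ultimately have "exp ((g \<bullet> x i)\<^sup>2 / (2 * N) - 1 / (4 * N)) \<le> exp (y\<^sup>2 / 2 - y ^ 4 / 4)"
      by simp
    also have "\<dots> \<le> cosh y"
      using y by (rule exp_le_cosh)
    finally show ?thesis by (simp add: y_def)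
  qed
  have "(\<Sum>i=1..N. (g \<bullet> x i)\<^sup>2 / (2 * N) - 1 / (4 * N)) = (\<Sum>i=1..N. (g \<bullet> x i)\<^sup>2) / (2 * N) - 1 / 4"
    using N_pos by (simp add: sum_subtractf sum_divide_distrib)
  then have "exp ((\<Sum>i=1..N. (g \<bullet> x i)\<^sup>2) / (2 * N) - 1 / 4)
      = (\<Prod>i=1..N. exp ((g \<bullet> x i)\<^sup>2 / (2 * N) - 1 / (4 * N)))"
    by (simp flip: exp_sum)
  also have "\<dots> \<le> (\<Prod>i=1..N. cosh (g \<bullet> x i / sqrt N))"
    by (intro prod_mono) (use le in auto)
  finally have "gauss g * exp ((\<Sum>i=1..N. (g \<bullet> x i)\<^sup>2) / (2 * N) - 1 / 4) \<le> field_weight g"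
    unfolding field_weight_def using gauss_pos[of g] by simp
  also have "gauss g * exp ((\<Sum>i=1..N. (g \<bullet> x i)\<^sup>2) / (2 * N) - 1 / 4) = exp (- 1 / 4) * exp (quad g)"
    unfolding gauss_def quad_def exp_add[symmetric] by simp
  finally show ?thesis .
qed

lemma quad_scale: "quad (2 *\<^sub>R g) = 4 * quad g"
  by (simp add: quad_def power_mult_distrib sum_distrib_left[symmetric] algebra_simps)

lemma compact_cube: "compact cube"
proof -
  have "cube = cbox (\<chi> \<nu>. - radius) (\<chi> \<nu>. radius)"
    by (auto simp: cube_def mem_box_cart abs_le_iff minus_le_iff)
  then show ?thesis by simp
qed

lemma integrable_cube:
  fixes f :: "real ^ 'm \<Rightarrow> real"
  assumes "continuous_on UNIV f"
  shows "integrable lborel (\<lambda>g. indicator cube g * f g)"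
  using borel_integrable_compact[OF compact_cube continuous_on_subset[OF assms]] by simp

lemma cube_borel [measurable]: "cube \<in> sets borel"
  using compact_cube by (simp add: borel_compact)

lemma continuous_quad: "continuous_on UNIV quad"
  unfolding quad_def[abs_def] by (intro continuous_intros) (use N_pos in auto)

text \<open>The diagonal of the quadratic form vanishes because the patterns have entries \<open>\<plusminus>1\<close>.\<close>

lemma integral_cube_quad: "(\<integral>g. indicator cube g * quad g \<partial>lborel) = 0"
proof -
  define w where "w = (\<lambda>\<nu> \<mu>. (\<Sum>i=1..N. x i $ \<nu> * x i $ \<mu>) / (2 * N) - (if \<nu> = \<mu> then 1 / 2 else 0))"
  have "x i $ \<nu> * x i $ \<nu> = 1" if "i \<in> {1..N}" for i \<nu>
    using pm[OF that, of \<nu>] by auto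
  then have w0: "w \<nu> \<nu> = 0" for \<nu>
    using N_pos by (simp add: w_def)
  have quad: "quad g = (\<Sum>\<nu>\<in>UNIV. \<Sum>\<mu>\<in>UNIV. w \<nu> \<mu> * (g $ \<nu> * g $ \<mu>))" for g
  proof -
    have "(\<Sum>i=1..N. (g \<bullet> x i)\<^sup>2) = (\<Sum>i=1..N. \<Sum>\<nu>\<in>UNIV. \<Sum>\<mu>\<in>UNIV. (x i $ \<nu> * x i $ \<mu>) * (g $ \<nu> * g $ \<mu>))"
      by (simp add: inner_vec_def power2_eq_square sum_product mult_ac)
    also have "\<dots> = (\<Sum>\<nu>\<in>UNIV. \<Sum>\<mu>\<in>UNIV. (\<Sum>i=1..N. x i $ \<nu> * x i $ \<mu>) * (g $ \<nu> * g $ \<mu>))"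
      by (subst sum.swap, intro sum.cong refl, subst sum.swap) (simp add: sum_distrib_right)
    finally have "(\<Sum>i=1..N. (g \<bullet> x i)\<^sup>2)
        = (\<Sum>\<nu>\<in>UNIV. \<Sum>\<mu>\<in>UNIV. (\<Sum>i=1..N. x i $ \<nu> * x i $ \<mu>) * (g $ \<nu> * g $ \<mu>))" .
    then have "(\<Sum>i=1..N. (g \<bullet> x i)\<^sup>2) / (2 * N)
        = (\<Sum>\<nu>\<in>UNIV. \<Sum>\<mu>\<in>UNIV. (\<Sum>i=1..N. x i $ \<nu> * x i $ \<mu>) / (2 * N) * (g $ \<nu> * g $ \<mu>))"
      by (simp only: times_divide_eq_left sum_divide_distrib[symmetric])
    moreover have "(norm g)\<^sup>2 / 2 = (\<Sum>\<nu>\<in>UNIV. \<Sum>\<mu>\<in>UNIV. (if \<nu> = \<mu> then 1 / 2 else 0) * (g $ \<nu> * g $ \<mu>))"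
      unfolding power2_norm_eq_inner
      by (simp add: inner_vec_def sum_divide_distrib if_distrib[of "\<lambda>t. t * _"] cong: if_cong)
    ultimately show ?thesis
      by (simp add: quad_def w_def left_diff_distrib sum_subtractf)
  qed
  have int: "integrable lborel (\<lambda>g. indicator cube g * (w \<nu> \<mu> * (g $ \<nu> * g $ \<mu>)))" for \<nu> \<mu>
    by (intro integrable_cube continuous_intros)
  have "(\<integral>g. indicator cube g * (w \<nu> \<mu> * (g $ \<nu> * g $ \<mu>)) \<partial>lborel) = 0" for \<nu> \<mu>
  proof (cases "\<nu> = \<mu>")
    case False
    \<comment> \<open>An off-diagonal monomial changes sign when coordinate \<open>\<nu>\<close> is
      reflected, while the cube is invariant.\<close>
    have mem: "(\<chi> \<kappa>. if \<kappa> = \<nu> then - g $ \<kappa> else g $ \<kappa>) \<in> cube \<longleftrightarrow> g \<in> cube" for g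
      by (auto simp: cube_def)
    then have ind: "indicator cube (\<chi> \<kappa>. if \<kappa> = \<nu> then - g $ \<kappa> else g $ \<kappa>) = (indicator cube g :: real)" for g
      by (simp add: indicator_def)
    show ?thesis
      by (rule integral_lborel_odd_coordinate[where \<nu> = \<nu>]) (use False ind in auto)
  qed (simp add: w0)
  then show ?thesis
    unfolding quad sum_distrib_left
    by (subst Bochner_Integration.integral_sum | intro Bochner_Integration.integrable_sum int | simp)+
qed

text \<open>The mass of the cube is at most the integral of exp (quad) over it, hence of exp (4
  quad), which by dilation is at most exp (1/4) / 2^M times the total mass, where M is
  \<open>CARD('m)\<close>. As M >= 1 and exp (1/4) <= 3/2, the factor is at most 3/4.\<close>

lemma field_weight_cube_le:
  "(\<integral>g. indicator cube g * field_weight g \<partial>lborel) \<le> 3 / 4 * integral\<^sup>L lborel field_weight"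
proof -
  let ?e = "exp (- 1 / 4) :: real"
  have int_exp: "integrable lborel (\<lambda>g. indicator cube g * exp (c * quad g))" for c
    by (intro integrable_cube continuous_intros continuous_quad)
  have exp4: "exp (1 * z) + 3 * z \<le> exp (4 * z)" for z :: real
  proof -
    \<comment> \<open>The factor exp z enlarges exp (3 z) - 1 when it is nonnegative and shrinks its
      modulus when it is negative, so in both cases it can only increase the value.\<close>
    have "3 * z \<le> exp z * (exp (3 * z) - 1)"
    proof (cases "0 \<le> z")
      case True
      have "3 * z \<le> exp (3 * z) - 1" using exp_ge_add_one_self[of "3 * z"] by linarith
      also have "\<dots> \<le> exp z * (exp (3 * z) - 1)"
        using True mult_right_mono[of 1 "exp z" "exp (3 * z) - 1"] by simp
      finally show ?thesis .
    next
      case False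
      have "3 * z \<le> exp (3 * z) - 1" using exp_ge_add_one_self[of "3 * z"] by linarith
      also have "\<dots> \<le> exp z * (exp (3 * z) - 1)"
        using False mult_right_mono_neg[of "exp z" 1 "exp (3 * z) - 1"] by simp
      finally show ?thesis .
    qed
    moreover have "exp (4 * z) = exp z * exp (3 * z)"
      by (simp flip: exp_add)
    ultimately show ?thesis by (simp add: algebra_simps)
  qed
  have "(\<integral>g. indicator cube g * field_weight g \<partial>lborel)
      \<le> (\<integral>g. indicator cube g * exp (1 * quad g) \<partial>lborel)"
    using integrable_real_mult_indicator[OF _ integrable_field_weight, of cube] int_exp[of 1]
    by (intro integral_mono) (auto simp: field_weight_le mult.commute split: split_indicator)
  \<comment> \<open>The added term integrates to 0 and prepares the pointwise inequality
    \<open>exp4\<close>.\<close>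
  also have "\<dots> = (\<integral>g. indicator cube g * exp (1 * quad g) + 3 * (indicator cube g * quad g) \<partial>lborel)"
    using int_exp[of 1] integrable_cube[OF continuous_quad]
    by (subst Bochner_Integration.integral_add) (auto simp: integral_cube_quad)
  also have "\<dots> \<le> (\<integral>g. indicator cube g * exp (4 * quad g) \<partial>lborel)"
    using int_exp[of 1] int_exp[of 4] integrable_cube[OF continuous_quad]
    by (intro integral_mono) (auto simp: exp4[simplified] split: split_indicator)
  finally have "?e * (\<integral>g. indicator cube g * field_weight g \<partial>lborel)
      \<le> ?e * (\<integral>g. indicator cube g * exp (4 * quad g) \<partial>lborel)"
    by simp
  also have "\<dots> = (\<integral>g. ?e * (indicator cube g * exp (4 * quad g)) \<partial>lborel)"
    by (rule integral_mult_right_zero[symmetric])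
  \<comment> \<open>By homogeneity the factor 4 is absorbed by doubling the argument, so the lower
    bound on \<open>field_weight\<close> can be applied at \<open>2 *\<^sub>R g\<close>.\<close>
  also have "\<dots> = (\<integral>g. indicator cube g * (?e * exp (quad (2 *\<^sub>R g))) \<partial>lborel)"
    by (simp only: quad_scale mult.left_commute)
  also have "\<dots> \<le> (\<integral>g. field_weight (2 *\<^sub>R g) \<partial>lborel)"
  proof (rule integral_mono)
    show "integrable lborel (\<lambda>g. indicator cube g * (?e * exp (quad (2 *\<^sub>R g))))"
      using integrable_mult_right[OF int_exp[of 4], of ?e] by (simp only: quad_scale mult.left_commute)
    have "integrable (density (distr lborel borel (\<lambda>g :: real ^ 'm. 0 + 2 *\<^sub>R g)) (\<lambda>_. ennreal (2 ^ CARD('m)))) field_weight"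
      using integrable_field_weight lborel_affine[of 2 "0 :: real ^ 'm"] by (simp add: ennreal_power[symmetric])
    then show "integrable lborel (\<lambda>g. field_weight (2 *\<^sub>R g))"
      by (subst (asm) integrable_real_density) (auto simp: integrable_distr_eq)
    fix g :: "real ^ 'm"
    have "?e * exp (quad (2 *\<^sub>R g)) \<le> field_weight (2 *\<^sub>R g)" if "g \<in> cube"
    proof (rule field_weight_ge)
      fix i assume i: "i \<in> {1..N}"
      have "\<bar>g \<bullet> x i\<bar> \<le> (\<Sum>\<nu>\<in>UNIV. \<bar>g $ \<nu> * x i $ \<nu>\<bar>)"
        unfolding inner_vec_def by (simp add: sum_abs)
      also have "\<dots> \<le> (\<Sum>\<nu>\<in>(UNIV :: 'm set). radius)"
      proof (rule sum_mono)
        fix \<nu>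
        have "\<bar>x i $ \<nu>\<bar> = 1" using pm[OF i, of \<nu>] by auto
        then show "\<bar>g $ \<nu> * x i $ \<nu>\<bar> \<le> radius"
          using that by (simp add: cube_def abs_mult)
      qed
      finally show "\<bar>(2 *\<^sub>R g) \<bullet> x i\<bar> \<le> sqrt (sqrt N)"
        by (simp add: radius_def abs_mult)
    qed
    then show "indicator cube g * (?e * exp (quad (2 *\<^sub>R g))) \<le> field_weight (2 *\<^sub>R g)"
      using field_weight_pos[of "2 *\<^sub>R g"] by (auto split: split_indicator)
  qed
  also have "\<dots> = integral\<^sup>L lborel field_weight / 2 ^ CARD('m)"
    by (subst (2) integral_lborel_scale[of _ 2]) auto
  also have "\<dots> \<le> integral\<^sup>L lborel field_weight / 2"
  proof -
    have "(2 :: real) ^ 1 \<le> 2 ^ CARD('m)"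
      by (intro power_increasing) (auto simp: Suc_le_eq)
    then show ?thesis
      using integral_lborel_pos[OF integrable_field_weight field_weight_pos] by (intro divide_left_mono) auto
  qed
  finally have *: "(\<integral>g. indicator cube g * field_weight g \<partial>lborel) \<le> exp (1 / 4) * (integral\<^sup>L lborel field_weight / 2)"
    by (simp add: exp_minus field_simps)
  have "exp (1 / 4 :: real) ^ 4 \<le> (3 / 2) ^ 4"
  proof -
    have "exp (1 / 4 :: real) ^ 4 = exp 1"
      unfolding exp_of_nat_mult[symmetric] by simp
    moreover have "(3 :: real) \<le> (3 / 2) ^ 4"
      by (simp add: power_divide)
    ultimately show ?thesis using exp_le by linarith
  qed
  then have "exp (1 / 4 :: real) \<le> 3 / 2"
    by (rule power_le_imp_le_base[of _ 3, simplified]) auto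
  moreover have "0 \<le> integral\<^sup>L lborel field_weight / 2"
    using integral_lborel_pos[OF integrable_field_weight field_weight_pos] by simp
  ultimately have "exp (1 / 4) * (integral\<^sup>L lborel field_weight / 2) \<le> 3 / 2 * (integral\<^sup>L lborel field_weight / 2)"
    by (rule mult_right_mono)
  with * show ?thesis by linarith
qed

end

section \<open>The marginal on a block of equal patterns\<close>

definition sign_vectors :: "(real ^ 'm) set" where
  "sign_vectors = {u. \<forall>\<nu>. u $ \<nu> \<in> {-1, 1}}"

lemma sign_vectors_eq_image: "(sign_vectors :: (real ^ 'm) set) = vec_lambda ` signs UNIV"
proof (intro equalityI subsetI)
  fix u :: "real ^ 'm" assume "u \<in> sign_vectors"
  then show "u \<in> vec_lambda ` signs UNIV"
    by (intro image_eqI[where x = "vec_nth u"]) (auto simp: sign_vectors_def)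
qed (auto simp: sign_vectors_def PiE_iff)

lemma finite_sign_vectors: "finite (sign_vectors :: (real ^ 'm) set)"
  unfolding sign_vectors_eq_image by (intro finite_imageI finite_signs) simp

lemma card_sign_vectors_le: "card (sign_vectors :: (real ^ 'm) set) \<le> 2 ^ CARD('m)"
  unfolding sign_vectors_eq_image
  using card_image_le[of "signs (UNIV :: 'm set)" vec_lambda] finite_signs[of "UNIV :: 'm set"]
  by (simp add: card_signs)

context sign_patterns
begin

text \<open>Pigeonhole: the complement of the cube has at least a quarter of the mass and is covered
  by the events that |g . u| exceeds \<open>radius\<close>, with \<open>u\<close> among at most 2^M
  sign vectors.\<close>

lemma exists_heavy_direction:
  obtains u where "u \<in> sign_vectors"
    "integral\<^sup>L lborel field_weight / (4 * 2 ^ CARD('m))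
      \<le> (\<integral>g. indicator {g. radius < \<bar>g \<bullet> u\<bar>} g * field_weight g \<partial>lborel)"
proof (rule ccontr)
  let ?q = "integral\<^sup>L lborel field_weight"
  let ?B = "\<lambda>u. \<integral>g. indicator {g. radius < \<bar>g \<bullet> u\<bar>} g * field_weight g \<partial>lborel"
  assume not: "\<not> thesis"
  note ex = that
  have less: "?B u < ?q / (4 * 2 ^ CARD('m))" if u: "u \<in> sign_vectors" for u
    using ex[OF u] not by (meson not_le)
  have q: "0 < ?q"
    using integrable_field_weight field_weight_pos by (rule integral_lborel_pos)
  have int: "integrable lborel (\<lambda>g. indicator S g * field_weight g)" if "S \<in> sets borel" for S
    using integrable_real_mult_indicator[OF _ integrable_field_weight, of S] that by (simp add: mult.commute)
  have intB: "integrable lborel (\<lambda>g. indicator {g. radius < \<bar>g \<bullet> u\<bar>} g * field_weight g)" for u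
    by (rule int) measurable
  have intC: "integrable lborel (\<lambda>g. indicator cube g * field_weight g)"
    by (rule int) measurable
  have "?q / 4 \<le> ?q - (\<integral>g. indicator cube g * field_weight g \<partial>lborel)"
    using field_weight_cube_le by simp
  also have "\<dots> = (\<integral>g. field_weight g - indicator cube g * field_weight g \<partial>lborel)"
    using integrable_field_weight intC by simp
  also have "\<dots> \<le> (\<integral>g. (\<Sum>u\<in>sign_vectors. indicator {g. radius < \<bar>g \<bullet> u\<bar>} g * field_weight g) \<partial>lborel)"
  proof (rule integral_mono)
    fix g
    show "field_weight g - indicator cube g * field_weight g
        \<le> (\<Sum>u\<in>sign_vectors. indicator {g. radius < \<bar>g \<bullet> u\<bar>} g * field_weight g)"
    proof (cases "g \<in> cube")
      case True
      then show ?thesis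
        using field_weight_pos[of g] by (auto intro!: sum_nonneg)
    next
      case False
      then obtain \<nu> where \<nu>: "radius < \<bar>g $ \<nu>\<bar>"
        by (auto simp: cube_def not_le)
      \<comment> \<open>Aligning \<open>u\<close> with the signs of \<open>g\<close> makes the inner
        product the l1-norm, which dominates every single coordinate.\<close>
      define u :: "real ^ 'm" where "u = (\<chi> \<mu>. if 0 \<le> g $ \<mu> then 1 else - 1)"
      have u: "u \<in> sign_vectors"
        by (simp add: u_def sign_vectors_def)
      have "g \<bullet> u = (\<Sum>\<mu>\<in>UNIV. \<bar>g $ \<mu>\<bar>)"
        unfolding inner_vec_def u_def by (intro sum.cong) auto
      moreover have "\<bar>g $ \<nu>\<bar> \<le> (\<Sum>\<mu>\<in>UNIV. \<bar>g $ \<mu>\<bar>)"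
        by (rule member_le_sum) auto
      ultimately have "radius < \<bar>g \<bullet> u\<bar>"
        using \<nu> by linarith
      then have "field_weight g - indicator cube g * field_weight g
          \<le> indicator {g. radius < \<bar>g \<bullet> u\<bar>} g * field_weight g"
        using False by simp
      also have "\<dots> \<le> (\<Sum>u\<in>sign_vectors. indicator {g. radius < \<bar>g \<bullet> u\<bar>} g * field_weight g)"
        using u finite_sign_vectors field_weight_pos[of g]
        by (intro member_le_sum[where f = "\<lambda>u. indicator {g. radius < \<bar>g \<bullet> u\<bar>} g * field_weight g"])
           (auto simp: less_imp_le)
      finally show ?thesis .
    qed
  next
    show "integrable lborel (\<lambda>g. field_weight g - indicator cube g * field_weight g)"
      using integrable_field_weight intC by (rule Bochner_Integration.integrable_diff)
    show "integrable lborel (\<lambda>g. \<Sum>u\<in>sign_vectors. indicator {g. radius < \<bar>g \<bullet> u\<bar>} g * field_weight g)"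
      by (intro Bochner_Integration.integrable_sum intB)
  qed
  also have "\<dots> = (\<Sum>u\<in>sign_vectors. ?B u)"
    by (intro Bochner_Integration.integral_sum intB)
  also have "\<dots> < (\<Sum>u\<in>(sign_vectors :: (real ^ 'm) set). ?q / (4 * 2 ^ CARD('m)))"
  proof (rule sum_strict_mono)
    have "(\<chi> \<nu>. 1) \<in> (sign_vectors :: (real ^ 'm) set)"
      by (simp add: sign_vectors_def)
    then show "(sign_vectors :: (real ^ 'm) set) \<noteq> {}" by blast
  qed (use less finite_sign_vectors in auto)
  also have "\<dots> = real (card (sign_vectors :: (real ^ 'm) set)) * (?q / (4 * 2 ^ CARD('m)))"
    by simp
  also have "\<dots> \<le> 2 ^ CARD('m) * (?q / (4 * 2 ^ CARD('m)))"
    using of_nat_mono[OF card_sign_vectors_le[where 'm = 'm], where 'a = real] q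
    by (intro mult_right_mono) auto
  also have "\<dots> = ?q / 4"
    by simp
  finally show False by simp
qed

text \<open>The Gibbs weight with the spins outside \<open>I\<close> summed out, when the block
  \<open>I\<close> has pattern \<open>u\<close> and spin sum \<open>t\<close>. The density F of the
  overview is \<open>2 ^ card I * boltzmann I t u / normalizer\<close>. The argument
  \<open>t\<close> is real so that convexity can be used between the attainable sums.\<close>

definition boltzmann :: "nat set \<Rightarrow> real \<Rightarrow> real ^ 'm \<Rightarrow> real" where
  "boltzmann I t u
    = (\<Sum>\<rho>\<in>signs ({1..N} - I). exp ((norm (t *\<^sub>R u + (\<Sum>i\<in>{1..N} - I. \<rho> i *\<^sub>R x i)))\<^sup>2 / (2 * real N)))"

definition normalizer :: real where
  "normalizer = (\<Sum>\<sigma>\<in>signs {1..N}. exp ((norm (\<Sum>i=1..N. \<sigma> i *\<^sub>R x i))\<^sup>2 / (2 * real N)))"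

lemma normalizer_pos: "0 < normalizer"
  unfolding normalizer_def
proof (rule sum_pos)
  have "(\<lambda>i\<in>{1..N}. 1) \<in> signs {1..N}" by auto
  then show "signs {1..N} \<noteq> {}" by blast
qed (auto intro!: finite_signs)

text \<open>A vanishing block sum removes from the field weight exactly the factor cosh (g . u /
  sqrt N)^n of the block, n being its size. That factor is at least 1 everywhere and at least 1 + s
  where |g . u| exceeds \<open>radius\<close>; \<open>heavy\<close> gives this region a fixed share
  of the mass, which produces the deficit.\<close>

lemma boltzmann_zero_le:
  assumes I: "I \<subseteq> {1..N}" "\<And>i. i \<in> I \<Longrightarrow> x i = u"
    and heavy: "integral\<^sup>L lborel field_weight / (4 * 2 ^ CARD('m))
      \<le> (\<integral>g. indicator {g. radius < \<bar>g \<bullet> u\<bar>} g * field_weight g \<partial>lborel)"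
    and s: "0 \<le> s" "s \<le> card I * radius\<^sup>2 / (2 * real N)"
  shows "2 ^ card I * boltzmann I 0 u \<le> (1 - s / (1 + s) / (4 * 2 ^ CARD('m))) * normalizer"
proof -
  let ?C = "integral\<^sup>L lborel (gauss :: real ^ 'm \<Rightarrow> real)"
  let ?q = "integral\<^sup>L lborel field_weight"
  let ?J = "{1..N} - I"
  let ?ind = "\<lambda>g. indicator {g. radius < \<bar>g \<bullet> u\<bar>} g :: real"
  define A where "A = (\<lambda>g. gauss g * (\<Prod>i\<in>?J. 2 * cosh (g \<bullet> x i / sqrt N)))"
  \<comment> \<open>The relative loss on the heavy region: 1 - r is the reciprocal of 1 + s.\<close>
  define r where "r = s / (1 + s)"
  have A: "integrable lborel A" "integral\<^sup>L lborel A = ?C * boltzmann I 0 u"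
    unfolding A_def boltzmann_def using hubbard_stratonovich[of ?J N x] N_pos by auto
  have A_pos: "0 < A g" for g
    by (simp add: A_def gauss_pos prod_pos)
  have Z: "2 ^ N * ?q = ?C * normalizer"
  proof -
    have "2 ^ N * ?q = (\<integral>g. 2 ^ N * field_weight g \<partial>lborel)"
      by simp
    also have "\<dots> = (\<integral>g. gauss g * (\<Prod>i=1..N. 2 * cosh (g \<bullet> x i / sqrt N)) \<partial>lborel)"
      by (intro Bochner_Integration.integral_cong) (simp_all add: field_weight_def prod.distrib)
    also have "\<dots> = ?C * normalizer"
      unfolding normalizer_def using N_pos by (intro hubbard_stratonovich) auto
    finally show ?thesis .
  qed
  have split: "2 ^ N * field_weight g = A g * (2 ^ card I * cosh (g \<bullet> u / sqrt N) ^ card I)" for g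
  proof -
    have "(\<Prod>i=1..N. 2 * cosh (g \<bullet> x i / sqrt N))
        = (\<Prod>i\<in>?J. 2 * cosh (g \<bullet> x i / sqrt N)) * (\<Prod>i\<in>I. 2 * cosh (g \<bullet> x i / sqrt N))"
      by (rule prod.subset_diff) (use I in auto)
    also have "(\<Prod>i\<in>I. 2 * cosh (g \<bullet> x i / sqrt N)) = (2 * cosh (g \<bullet> u / sqrt N)) ^ card I"
      using I by simp
    finally show ?thesis
      by (simp add: A_def field_weight_def prod.distrib power_mult_distrib)
  qed
  have pointwise: "2 ^ card I * A g \<le> 2 ^ N * (field_weight g - r * (?ind g * field_weight g))" for g
  proof -
    let ?c = "cosh (g \<bullet> u / sqrt N) ^ card I"
    have "1 \<le> ?c"
      by (simp add: one_le_power cosh_real_ge_1)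
    moreover have "1 + s \<le> ?c" if "radius < \<bar>g \<bullet> u\<bar>"
    proof -
      have "radius\<^sup>2 \<le> (g \<bullet> u)\<^sup>2"
        using that radius_pos by (simp add: abs_le_square_iff[symmetric])
      have "s \<le> card I * ((g \<bullet> u)\<^sup>2 / (2 * real N))"
      proof (rule order_trans[OF s(2)])
        show "card I * radius\<^sup>2 / (2 * real N) \<le> card I * ((g \<bullet> u)\<^sup>2 / (2 * real N))"
          unfolding times_divide_eq_right
          using \<open>radius\<^sup>2 \<le> (g \<bullet> u)\<^sup>2\<close> by (intro divide_right_mono mult_left_mono) auto
      qed
      also have "(g \<bullet> u)\<^sup>2 / (2 * real N) = (g \<bullet> u / sqrt N)\<^sup>2 / 2"
        by (simp add: power_divide)
      finally have "1 + s \<le> 1 + card I * ((g \<bullet> u / sqrt N)\<^sup>2 / 2)"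
        by simp
      \<comment> \<open>Bernoulli's inequality gathers the small gains of all block sites into the
        single gain \<open>s\<close>.\<close>
      also have "\<dots> \<le> (1 + (g \<bullet> u / sqrt N)\<^sup>2 / 2) ^ card I"
        by (rule Bernoulli_inequality) (auto intro: order_trans[of _ 0])
      also have "\<dots> \<le> ?c"
        by (intro power_mono one_plus_half_square_le_cosh) auto
      finally show ?thesis .
    qed
    moreover have "1 - r = 1 / (1 + s)"
      using s by (simp add: r_def field_simps)
    ultimately have "1 \<le> (1 - r * ?ind g) * ?c"
      using s by (cases "radius < \<bar>g \<bullet> u\<bar>") auto
    then have "(2 ^ card I * A g) * 1 \<le> (2 ^ card I * A g) * ((1 - r * ?ind g) * ?c)"
      using A_pos[of g] by (intro mult_left_mono) auto
    also have "\<dots> = (1 - r * ?ind g) * (2 ^ N * field_weight g)"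
      unfolding split by simp
    also have "\<dots> = 2 ^ N * (field_weight g - r * (?ind g * field_weight g))"
      by (simp add: algebra_simps)
    finally show ?thesis by simp
  qed
  have int: "integrable lborel (\<lambda>g. ?ind g * field_weight g)"
    using integrable_real_mult_indicator[OF _ integrable_field_weight, of "{g. radius < \<bar>g \<bullet> u\<bar>}"]
    by (simp add: mult.commute)
  have r: "0 \<le> r" using s by (simp add: r_def)
  have "2 ^ card I * (?C * boltzmann I 0 u) = (\<integral>g. 2 ^ card I * A g \<partial>lborel)"
    using A by simp
  also have "\<dots> \<le> (\<integral>g. 2 ^ N * (field_weight g - r * (?ind g * field_weight g)) \<partial>lborel)"
    by (intro integral_mono pointwise integrable_mult_right Bochner_Integration.integrable_diff
        integrable_field_weight int A)
  also have "\<dots> = 2 ^ N * (?q - r * (\<integral>g. ?ind g * field_weight g \<partial>lborel))"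
    using integrable_field_weight int by simp
  also have "\<dots> \<le> 2 ^ N * (?q - r * (?q / (4 * 2 ^ CARD('m))))"
    using heavy r by (intro mult_left_mono diff_left_mono) auto
  also have "\<dots> = (1 - r / (4 * 2 ^ CARD('m))) * (2 ^ N * ?q)"
    by (simp add: algebra_simps)
  also have "\<dots> = ?C * ((1 - r / (4 * 2 ^ CARD('m))) * normalizer)"
    unfolding Z by simp
  finally have "?C * (2 ^ card I * boltzmann I 0 u) \<le> ?C * ((1 - r / (4 * 2 ^ CARD('m))) * normalizer)"
    by (simp add: mult_ac)
  moreover have "0 < ?C"
    using integrable_gauss gauss_pos by (rule integral_lborel_pos)
  ultimately show ?thesis
    unfolding r_def by (simp only: mult_le_cancel_left_pos)
qed

text \<open>The squared norm of an affine function of \<open>t\<close> is convex, the exponential is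
  convex and increasing, and finite sums preserve convexity.\<close>

lemma convex_boltzmann: "convex_on UNIV (\<lambda>t. boltzmann I t u)"
proof -
  have conv: "convex_on UNIV (\<lambda>t. exp ((norm (t *\<^sub>R u + v))\<^sup>2 / (2 * real N)))" for v
  proof (rule convex_onI)
    fix a s t :: real assume a: "0 < a" "a < 1"
    let ?n = "\<lambda>t. (norm (t *\<^sub>R u + v))\<^sup>2"
    have "?n ((1 - a) * s + a * t) = (1 - a) * ?n s + a * ?n t - a * (1 - a) * (s - t)\<^sup>2 * (norm u)\<^sup>2"
      unfolding power2_norm_eq_inner
      by (simp add: inner_add_left inner_add_right inner_commute[of v u] power2_eq_square) algebra
    then have "?n ((1 - a) * s + a * t) \<le> (1 - a) * ?n s + a * ?n t"
      using a by simp
    then have "?n ((1 - a) * s + a * t) / (2 * real N) \<le> ((1 - a) * ?n s + a * ?n t) / (2 * real N)"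
      by (rule divide_right_mono) simp
    also have "\<dots> = (1 - a) * (?n s / (2 * real N)) + a * (?n t / (2 * real N))"
      by (simp add: add_divide_distrib)
    finally have "exp (?n ((1 - a) * s + a * t) / (2 * real N)) \<le> exp ((1 - a) * (?n s / (2 * real N)) + a * (?n t / (2 * real N)))"
      by simp
    also have "\<dots> \<le> (1 - a) * exp (?n s / (2 * real N)) + a * exp (?n t / (2 * real N))"
      using convex_onD[OF convex_on_exp[of 1], of a "?n s / (2 * real N)" "?n t / (2 * real N)"] a by simp
    finally show "exp (?n ((1 - a) *\<^sub>R s + a *\<^sub>R t) / (2 * real N))
        \<le> (1 - a) * exp (?n s / (2 * real N)) + a * exp (?n t / (2 * real N))"
      by simp
  qed simp
  have "convex_on UNIV (\<lambda>t. \<Sum>\<rho>\<in>S. exp ((norm (t *\<^sub>R u + v \<rho>))\<^sup>2 / (2 * real N)))"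
    if "finite S" for v and S :: "(nat \<Rightarrow> real) set"
    using that by induction (auto intro!: convex_on_add conv simp: convex_on_const)
  then show ?thesis
    unfolding boltzmann_def by (simp add: finite_signs)
qed

text \<open>Flipping all spins outside the block negates the whole vector inside the norm, up to the
  sign of \<open>t\<close>.\<close>

lemma boltzmann_minus: "boltzmann I (- t) u = boltzmann I t u"
proof -
  let ?J = "{1..N} - I"
  have "boltzmann I t u = (\<Sum>\<rho>\<in>signs ?J. exp ((norm (t *\<^sub>R u + (\<Sum>i\<in>?J. (\<lambda>i\<in>?J. - \<rho> i) i *\<^sub>R x i)))\<^sup>2 / (2 * real N)))"
    unfolding boltzmann_def
    by (rule sum_signs_uminus[where f = "\<lambda>\<rho>. exp ((norm (t *\<^sub>R u + (\<Sum>i\<in>?J. \<rho> i *\<^sub>R x i)))\<^sup>2 / (2 * real N))", symmetric])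
  also have "\<dots> = boltzmann I (- t) u"
    unfolding boltzmann_def
  proof (intro sum.cong refl)
    fix \<rho>
    have "t *\<^sub>R u + (\<Sum>i\<in>?J. (\<lambda>i\<in>?J. - \<rho> i) i *\<^sub>R x i) = - (- t *\<^sub>R u + (\<Sum>i\<in>?J. \<rho> i *\<^sub>R x i))"
      by (simp add: sum_negf)
    then show "exp ((norm (t *\<^sub>R u + (\<Sum>i\<in>?J. (\<lambda>i\<in>?J. - \<rho> i) i *\<^sub>R x i)))\<^sup>2 / (2 * real N))
        = exp ((norm (- t *\<^sub>R u + (\<Sum>i\<in>?J. \<rho> i *\<^sub>R x i)))\<^sup>2 / (2 * real N))"
      by (simp only: norm_minus_cancel)
  qed
  finally show ?thesis ..
qed

lemma boltzmann_half: "boltzmann I (t / 2) u \<le> (boltzmann I 0 u + boltzmann I t u) / 2"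
  using convex_onD[OF convex_boltzmann, of "1 / 2" 0 t I u] by simp

text \<open>An even convex function is nondecreasing in the modulus of its argument:
  \<open>s\<close> is a convex combination of the two points of modulus
  \<open>\<bar>t\<bar>\<close>, where the values agree.\<close>

lemma boltzmann_mono:
  assumes "\<bar>s\<bar> \<le> \<bar>t\<bar>"
  shows "boltzmann I s u \<le> boltzmann I t u"
proof (cases "t = 0")
  case False
  define a where "a = (s / \<bar>t\<bar> + 1) / 2"
  have a: "0 \<le> a" "a \<le> 1"
    using assms False by (auto simp: a_def field_simps abs_le_iff)
  have "s = (1 - a) * (- \<bar>t\<bar>) + a * \<bar>t\<bar>"
    using False by (simp add: a_def field_simps)
  then have "boltzmann I s u \<le> (1 - a) * boltzmann I (- \<bar>t\<bar>) u + a * boltzmann I \<bar>t\<bar> u"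
    using convex_onD[OF convex_boltzmann, of a "- \<bar>t\<bar>" "\<bar>t\<bar>" I u] a by simp
  also have "\<dots> = boltzmann I \<bar>t\<bar> u"
    unfolding boltzmann_minus by (simp add: algebra_simps)
  also have "\<dots> = boltzmann I t u"
    using boltzmann_minus[of I t u] by (cases "0 \<le> t") auto
  finally show ?thesis .
qed (use assms in simp)

text \<open>Since all patterns in \<open>I\<close> equal \<open>u\<close>, the block spins enter the
  weight only through their sum, and the remaining spins are summed out.\<close>

lemma sum_signs_block:
  assumes I: "I \<subseteq> {1..N}" "\<And>i. i \<in> I \<Longrightarrow> x i = u"
  shows "(\<Sum>\<sigma>\<in>{\<sigma>\<in>signs {1..N}. P (\<Sum>i\<in>I. \<sigma> i)}. exp ((norm (\<Sum>i=1..N. \<sigma> i *\<^sub>R x i))\<^sup>2 / (2 * real N)))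
      = (\<Sum>\<tau>\<in>{\<tau>\<in>signs I. P (\<Sum>i\<in>I. \<tau> i)}. boltzmann I (\<Sum>i\<in>I. \<tau> i) u)"
proof -
  let ?J = "{1..N} - I"
  let ?w = "\<lambda>\<sigma>. exp ((norm (\<Sum>i=1..N. \<sigma> i *\<^sub>R x i))\<^sup>2 / (2 * real N))"
  have fin: "finite I" using I(1) finite_subset by auto
  have Un: "I \<union> ?J = {1..N}" using I by auto
  have disj: "I \<inter> ?J = {}" by auto
  have m1: "(\<Sum>i\<in>I. merge I ?J (\<tau>, \<rho>) i) = (\<Sum>i\<in>I. \<tau> i)" for \<tau> \<rho> :: "nat \<Rightarrow> real"
    by (intro sum.cong) (auto simp: merge_def)
  have m2: "(\<Sum>i=1..N. merge I ?J (\<tau>, \<rho>) i *\<^sub>R x i) = (\<Sum>i\<in>I. \<tau> i) *\<^sub>R u + (\<Sum>i\<in>?J. \<rho> i *\<^sub>R x i)" for \<tau> \<rho>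
  proof -
    have "(\<Sum>i=1..N. merge I ?J (\<tau>, \<rho>) i *\<^sub>R x i)
        = (\<Sum>i\<in>?J. merge I ?J (\<tau>, \<rho>) i *\<^sub>R x i) + (\<Sum>i\<in>I. merge I ?J (\<tau>, \<rho>) i *\<^sub>R x i)"
      by (rule sum.subset_diff) (use I in auto)
    also have "(\<Sum>i\<in>I. merge I ?J (\<tau>, \<rho>) i *\<^sub>R x i) = (\<Sum>i\<in>I. \<tau> i *\<^sub>R u)"
      using I by (intro sum.cong) (auto simp: merge_def)
    also have "(\<Sum>i\<in>?J. merge I ?J (\<tau>, \<rho>) i *\<^sub>R x i) = (\<Sum>i\<in>?J. \<rho> i *\<^sub>R x i)"
      by (intro sum.cong) (auto simp: merge_def)
    finally show ?thesis by (simp add: scaleR_sum_left add.commute)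
  qed
  have "(\<Sum>\<sigma>\<in>{\<sigma>\<in>signs {1..N}. P (\<Sum>i\<in>I. \<sigma> i)}. ?w \<sigma>)
      = (\<Sum>\<sigma>\<in>signs (I \<union> ?J). if P (\<Sum>i\<in>I. \<sigma> i) then ?w \<sigma> else 0)"
    unfolding Un by (rule sum.inter_filter) (simp add: finite_signs)
  also have "\<dots> = (\<Sum>\<tau>\<in>signs I. if P (\<Sum>i\<in>I. \<tau> i) then boltzmann I (\<Sum>i\<in>I. \<tau> i) u else 0)"
    unfolding sum_signs_Un[OF disj] m1 m2 boltzmann_def by (intro sum.cong) auto
  also have "\<dots> = (\<Sum>\<tau>\<in>{\<tau>\<in>signs I. P (\<Sum>i\<in>I. \<tau> i)}. boltzmann I (\<Sum>i\<in>I. \<tau> i) u)"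
    by (rule sum.inter_filter[symmetric]) (simp add: finite_signs fin)
  finally show ?thesis .
qed

text \<open>Dichotomy at the median \<open>m\<close>. If F m is at least 1 + \<kappa>, monotonicity
  keeps F that large on the upper tail. Otherwise midpoint convexity gives F (m / 2) at most ((1 - 3
  \<kappa>) + (1 + \<kappa>)) / 2 = 1 - \<kappa>, and monotonicity keeps F that small on the inner
  window. Either event has uniform probability at least 1/6.\<close>

lemma exists_separating_event:
  assumes I: "I \<subseteq> {1..N}" "even (card I)"
    and \<kappa>: "0 \<le> \<kappa>" "2 ^ card I * boltzmann I 0 u \<le> (1 - 3 * \<kappa>) * normalizer"
  obtains P where "\<kappa> / 6 \<le> \<bar>(\<Sum>\<tau>\<in>{\<tau>\<in>signs I. P (\<Sum>i\<in>I. \<tau> i)}. boltzmann I (\<Sum>i\<in>I. \<tau> i) u) / normalizer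
      - real (card {\<tau>\<in>signs I. P (\<Sum>i\<in>I. \<tau> i)}) / 2 ^ card I\<bar>"
proof -
  have fin: "finite I" using I(1) finite_subset by auto
  obtain m where m: "0 \<le> m"
    "real (card {\<tau> \<in> signs I. m \<le> \<bar>\<Sum>i\<in>I. \<tau> i\<bar>}) \<ge> 2 ^ card I / 6"
    "real (card {\<tau> \<in> signs I. \<bar>\<Sum>i\<in>I. \<tau> i\<bar> \<le> m / 2}) \<ge> 2 ^ card I / 6"
    using rademacher_sum_quantile[OF fin I(2)] by blast
  let ?Z = normalizer
  note Z = normalizer_pos
  show ?thesis
  proof (cases "(1 + \<kappa>) * ?Z \<le> 2 ^ card I * boltzmann I m u")
    case True
    let ?A = "{\<tau> \<in> signs I. m \<le> \<bar>\<Sum>i\<in>I. \<tau> i\<bar>}"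
    have "(\<Sum>\<tau>\<in>?A. boltzmann I m u) \<le> (\<Sum>\<tau>\<in>?A. boltzmann I (\<Sum>i\<in>I. \<tau> i) u)"
      using m(1) by (intro sum_mono boltzmann_mono) auto
    then have "real (card ?A) * boltzmann I m u \<le> (\<Sum>\<tau>\<in>?A. boltzmann I (\<Sum>i\<in>I. \<tau> i) u)"
      by simp
    moreover have "real (card ?A) * ((1 + \<kappa>) * ?Z / 2 ^ card I) \<le> real (card ?A) * boltzmann I m u"
      using True by (intro mult_left_mono) (auto simp: field_simps)
    ultimately have "real (card ?A) * ((1 + \<kappa>) * ?Z / 2 ^ card I) / ?Z
        \<le> (\<Sum>\<tau>\<in>?A. boltzmann I (\<Sum>i\<in>I. \<tau> i) u) / ?Z"
      using Z by (intro divide_right_mono) auto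
    moreover have "real (card ?A) * ((1 + \<kappa>) * ?Z / 2 ^ card I) / ?Z
        = real (card ?A) / 2 ^ card I + \<kappa> * (real (card ?A) / 2 ^ card I)"
      using Z by (simp add: field_simps)
    moreover have "\<kappa> * (1 / 6) \<le> \<kappa> * (real (card ?A) / 2 ^ card I)"
      using m(2) \<kappa>(1) by (intro mult_left_mono) (auto simp: field_simps)
    ultimately show ?thesis
      by (intro that[of "\<lambda>t. m \<le> \<bar>t\<bar>"]) linarith
  next
    case False
    let ?A = "{\<tau> \<in> signs I. \<bar>\<Sum>i\<in>I. \<tau> i\<bar> \<le> m / 2}"
    have "2 ^ card I * boltzmann I (m / 2) u \<le> 2 ^ card I * ((boltzmann I 0 u + boltzmann I m u) / 2)"
      by (intro mult_left_mono boltzmann_half) auto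
    also have "\<dots> = (2 ^ card I * boltzmann I 0 u + 2 ^ card I * boltzmann I m u) / 2"
      by (simp add: algebra_simps)
    also have "\<dots> \<le> ((1 - 3 * \<kappa>) * ?Z + (1 + \<kappa>) * ?Z) / 2"
      using \<kappa>(2) False by (intro divide_right_mono add_mono) auto
    also have "\<dots> = (1 - \<kappa>) * ?Z"
      by (simp add: field_simps)
    finally have half: "2 ^ card I * boltzmann I (m / 2) u \<le> (1 - \<kappa>) * ?Z" .
    have "(\<Sum>\<tau>\<in>?A. boltzmann I (\<Sum>i\<in>I. \<tau> i) u) \<le> (\<Sum>\<tau>\<in>?A. boltzmann I (m / 2) u)"
      using m(1) by (intro sum_mono boltzmann_mono) auto
    then have "(\<Sum>\<tau>\<in>?A. boltzmann I (\<Sum>i\<in>I. \<tau> i) u) \<le> real (card ?A) * boltzmann I (m / 2) u"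
      by simp
    moreover have "real (card ?A) * boltzmann I (m / 2) u \<le> real (card ?A) * ((1 - \<kappa>) * ?Z / 2 ^ card I)"
      using half by (intro mult_left_mono) (auto simp: field_simps)
    ultimately have "(\<Sum>\<tau>\<in>?A. boltzmann I (\<Sum>i\<in>I. \<tau> i) u) / ?Z
        \<le> real (card ?A) * ((1 - \<kappa>) * ?Z / 2 ^ card I) / ?Z"
      using Z by (intro divide_right_mono) auto
    moreover have "real (card ?A) * ((1 - \<kappa>) * ?Z / 2 ^ card I) / ?Z
        = real (card ?A) / 2 ^ card I - \<kappa> * (real (card ?A) / 2 ^ card I)"
      using Z by (simp add: field_simps)
    moreover have "\<kappa> * (1 / 6) \<le> \<kappa> * (real (card ?A) / 2 ^ card I)"
      using m(3) \<kappa>(1) by (intro mult_left_mono) (auto simp: field_simps)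
    ultimately show ?thesis
      by (intro that[of "\<lambda>t. \<bar>t\<bar> \<le> m / 2"]) linarith
  qed
qed

end

section \<open>Total variation distance\<close>

lemma abs_measure_diff_le_tv_dist:
  assumes "finite_measure \<nu>" "finite_measure \<rho>" "A \<in> sets \<nu>"
  shows "\<bar>measure \<nu> A - measure \<rho> A\<bar> \<le> tv_dist \<nu> \<rho>"
  unfolding tv_dist_def
proof (rule cSUP_upper[OF assms(3)])
  show "bdd_above ((\<lambda>A. \<bar>measure \<nu> A - measure \<rho> A\<bar>) ` sets \<nu>)"
  proof (intro bdd_aboveI2)
    fix B
    have "measure \<nu> B \<le> measure \<nu> (space \<nu>)" "measure \<rho> B \<le> measure \<rho> (space \<rho>)"
      using assms by (auto intro: finite_measure.bounded_measure)
    then show "\<bar>measure \<nu> B - measure \<rho> B\<bar> \<le> measure \<nu> (space \<nu>) + measure \<rho> (space \<rho>)"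
      using measure_nonneg[of \<nu> B] measure_nonneg[of \<rho> B] by linarith
  qed
qed

section \<open>Finite formulas for the Gibbs marginal and the Rademacher product\<close>

lemma spins_eq_signs: "spins n = signs {1..n}"
  by (simp add: spins_def)

lemma PiM_count_space_signs:
  "(\<Pi>\<^sub>M i\<in>{1..k}. count_space {-1, 1 :: real}) = count_space (spins k)"
  unfolding spins_def by (rule count_space_PiM_finite) auto

lemma prob_space_rademacher: "prob_space rademacher"
  unfolding rademacher_def by (rule prob_space_uniform_count_measure) auto

lemma prob_space_rademacher_power: "prob_space (rademacher_power k)"
  unfolding rademacher_power_def by (intro prob_space_PiM prob_space_rademacher)

lemma sets_rademacher_power: "sets (rademacher_power k) = Pow (spins k)"
proof -
  have "sets (rademacher_power k) = sets (\<Pi>\<^sub>M i\<in>{1..k}. count_space {-1, 1 :: real})"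
    unfolding rademacher_power_def by (intro sets_PiM_cong) (simp_all add: rademacher_def sets_uniform_count_measure)
  then show ?thesis unfolding PiM_count_space_signs by simp
qed

lemma measure_rademacher_power:
  assumes "B \<subseteq> spins k"
  shows "measure (rademacher_power k) B = real (card B) / 2 ^ k"
proof -
  interpret M: prob_space rademacher
    by (rule prob_space_rademacher)
  interpret R: finite_product_prob_space "\<lambda>_ :: nat. rademacher" "{1..k}"
    by unfold_locales auto
  interpret P: prob_space "rademacher_power k"
    by (rule prob_space_rademacher_power)
  have fin: "finite B"
    using assms finite_signs[of "{1..k}"] finite_subset by (auto simp: spins_eq_signs)
  have single: "measure (rademacher_power k) {\<tau>} = 1 / 2 ^ k" if "\<tau> \<in> spins k" for \<tau>
  proof -
    have \<tau>: "\<tau> i \<in> {-1, 1}" if "i \<in> {1..k}" for i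
      using \<open>\<tau> \<in> spins k\<close> that by (auto simp: spins_def PiE_iff)
    have "{\<tau>} = (\<Pi>\<^sub>E i\<in>{1..k}. {\<tau> i})"
      using that by (subst PiE_singleton) (auto simp: spins_def PiE_def)
    then have "measure (rademacher_power k) {\<tau>} = measure (PiM {1..k} (\<lambda>_. rademacher)) (\<Pi>\<^sub>E i\<in>{1..k}. {\<tau> i})"
      by (simp add: rademacher_power_def)
    also have "\<dots> = (\<Prod>i\<in>{1..k}. measure rademacher {\<tau> i})"
      using \<tau> by (intro R.prob_times) (auto simp: rademacher_def sets_uniform_count_measure)
    also have "\<dots> = (\<Prod>i\<in>{1..k}. 1 / 2)"
      using \<tau> by (intro prod.cong refl) (simp add: rademacher_def measure_uniform_count_measure)
    finally show ?thesis by (simp add: power_divide)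
  qed
  have "measure (rademacher_power k) B = (\<Sum>\<tau>\<in>B. measure (rademacher_power k) {\<tau>})"
    using assms fin by (intro P.finite_measure_eq_sum_singleton) (auto simp: sets_rademacher_power)
  also have "\<dots> = (\<Sum>\<tau>\<in>B. 1 / 2 ^ k)"
    using assms by (intro sum.cong single) auto
  finally show ?thesis by simp
qed

context sign_patterns
begin

lemma gibbs_weight_eq: "gibbs_weight 1 N x \<sigma> = exp ((norm (\<Sum>i=1..N. \<sigma> i *\<^sub>R x i))\<^sup>2 / (2 * real N))"
  using N_pos by (simp add: gibbs_weight_def overlap_def power_mult_distrib power_divide power2_eq_square[of "real N"])

lemma partition_function_eq: "partition_function 1 N x = normalizer"
  by (simp add: partition_function_def normalizer_def gibbs_weight_eq spins_eq_signs)

lemma finite_spins: "finite (spins n)"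
  unfolding spins_eq_signs by (rule finite_signs) simp

lemma emeasure_gibbs:
  assumes "B \<subseteq> spins N"
  shows "emeasure (gibbs 1 N x) B = ennreal (\<Sum>\<sigma>\<in>B. gibbs_weight 1 N x \<sigma> / normalizer)"
  unfolding gibbs_def partition_function_eq
  using assms normalizer_pos finite_spins
  by (subst emeasure_point_measure_finite) (auto simp: gibbs_weight_def sum_ennreal)

lemma measure_gibbs:
  assumes "B \<subseteq> spins N"
  shows "measure (gibbs 1 N x) B = (\<Sum>\<sigma>\<in>B. gibbs_weight 1 N x \<sigma>) / normalizer"
  using emeasure_gibbs[OF assms] normalizer_pos
  by (simp add: measure_def sum_divide_distrib[symmetric] sum_nonneg gibbs_weight_def)

lemma space_gibbs: "space (gibbs 1 N x) = spins N"
  by (simp add: gibbs_def space_point_measure)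

lemma finite_measure_gibbs: "finite_measure (gibbs 1 N x)"
  by (rule finite_measureI) (simp add: space_gibbs emeasure_gibbs)

lemma measurable_restrict_gibbs:
  assumes "k \<le> N"
  shows "(\<lambda>\<sigma>. restrict \<sigma> {1..k}) \<in> gibbs 1 N x \<rightarrow>\<^sub>M count_space (spins k)"
  unfolding gibbs_def using assms
  by (auto simp: measurable_point_measure_eq1 spins_def PiE_iff)

lemma measure_gibbs_marginal:
  assumes "k \<le> N" "B \<subseteq> spins k"
  shows "measure (gibbs_marginal 1 N x k) B
    = (\<Sum>\<sigma>\<in>{\<sigma>\<in>spins N. restrict \<sigma> {1..k} \<in> B}. gibbs_weight 1 N x \<sigma>) / normalizer"
proof -
  have "measure (gibbs_marginal 1 N x k) B
      = measure (gibbs 1 N x) ((\<lambda>\<sigma>. restrict \<sigma> {1..k}) -` B \<inter> space (gibbs 1 N x))"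
    unfolding gibbs_marginal_def PiM_count_space_signs
    using assms measurable_restrict_gibbs by (intro measure_distr) auto
  also have "(\<lambda>\<sigma>. restrict \<sigma> {1..k}) -` B \<inter> space (gibbs 1 N x) = {\<sigma>\<in>spins N. restrict \<sigma> {1..k} \<in> B}"
    by (auto simp: space_gibbs)
  also have "measure (gibbs 1 N x) \<dots> = (\<Sum>\<sigma>\<in>{\<sigma>\<in>spins N. restrict \<sigma> {1..k} \<in> B}. gibbs_weight 1 N x \<sigma>) / normalizer"
    by (rule measure_gibbs) auto
  finally show ?thesis .
qed

lemma finite_measure_gibbs_marginal:
  assumes "k \<le> N"
  shows "finite_measure (gibbs_marginal 1 N x k)"
  unfolding gibbs_marginal_def PiM_count_space_signs
  using finite_measure.finite_measure_distr[OF finite_measure_gibbs measurable_restrict_gibbs[OF assms]] .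

text \<open>An event about the block sum is an event about the first \<open>k\<close> spins, so the
  separation found on the block bounds the distance of the full marginals from below.\<close>

lemma tv_dist_ge_of_block:
  assumes k: "k \<le> N" and I: "I \<subseteq> {1..k}" "even (card I)" "\<And>i. i \<in> I \<Longrightarrow> x i = u"
    and heavy: "integral\<^sup>L lborel field_weight / (4 * 2 ^ CARD('m))
      \<le> (\<integral>g. indicator {g. radius < \<bar>g \<bullet> u\<bar>} g * field_weight g \<partial>lborel)"
    and s: "0 \<le> s" "s \<le> card I * radius\<^sup>2 / (2 * real N)"
  shows "s / (1 + s) / (72 * 2 ^ CARD('m)) \<le> tv_dist (gibbs_marginal 1 N x k) (rademacher_power k)"
proof -
  let ?r = "s / (1 + s)"
  \<comment> \<open>Chosen so that \<open>3 * \<kappa>\<close> is the deficit in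
    \<open>boltzmann_zero_le\<close>; the final bound \<open>\<kappa> / 6\<close> then has
    denominator 12 * 6 = 72.\<close>
  define \<kappa> where "\<kappa> = ?r / (12 * 2 ^ CARD('m))"
  have fin: "finite I" using I(1) finite_subset by auto
  have IN: "I \<subseteq> {1..N}" using I(1) k by auto
  have \<kappa>: "0 \<le> \<kappa>" using s by (simp add: \<kappa>_def)
  have "2 ^ card I * boltzmann I 0 u \<le> (1 - ?r / (4 * 2 ^ CARD('m))) * normalizer"
    using IN I(3) heavy s by (rule boltzmann_zero_le)
  also have "?r / (4 * 2 ^ CARD('m)) = 3 * \<kappa>"
    by (simp add: \<kappa>_def)
  finally have "2 ^ card I * boltzmann I 0 u \<le> (1 - 3 * \<kappa>) * normalizer" .
  from exists_separating_event[OF IN I(2) \<kappa> this]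
  obtain P where P: "\<kappa> / 6 \<le> \<bar>(\<Sum>\<tau>\<in>{\<tau>\<in>signs I. P (\<Sum>i\<in>I. \<tau> i)}. boltzmann I (\<Sum>i\<in>I. \<tau> i) u) / normalizer
      - real (card {\<tau>\<in>signs I. P (\<Sum>i\<in>I. \<tau> i)}) / 2 ^ card I\<bar>" by blast
  define B where "B = {\<tau>\<in>spins k. P (\<Sum>i\<in>I. \<tau> i)}"
  have B: "B \<subseteq> spins k" by (auto simp: B_def)
  have "measure (gibbs_marginal 1 N x k) B
      = (\<Sum>\<tau>\<in>{\<tau>\<in>signs I. P (\<Sum>i\<in>I. \<tau> i)}. boltzmann I (\<Sum>i\<in>I. \<tau> i) u) / normalizer"
  proof -
    have "restrict \<sigma> {1..k} \<in> B \<longleftrightarrow> P (\<Sum>i\<in>I. \<sigma> i)" if "\<sigma> \<in> spins N" for \<sigma>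
    proof -
      have "(\<Sum>i\<in>I. restrict \<sigma> {1..k} i) = (\<Sum>i\<in>I. \<sigma> i)"
        using I(1) by (intro sum.cong) auto
      moreover have "restrict \<sigma> {1..k} \<in> spins k"
        using that k by (auto simp: spins_def PiE_iff)
      ultimately show ?thesis by (simp add: B_def)
    qed
    then have "{\<sigma>\<in>spins N. restrict \<sigma> {1..k} \<in> B} = {\<sigma>\<in>signs {1..N}. P (\<Sum>i\<in>I. \<sigma> i)}"
      by (auto simp: spins_eq_signs)
    then show ?thesis
      using measure_gibbs_marginal[OF k B] sum_signs_block[OF IN I(3), of P] by (simp add: gibbs_weight_eq)
  qed
  \<comment> \<open>The coordinates outside \<open>I\<close> are free and contribute the same power
    of 2 to the count and to the total.\<close>
  moreover have "measure (rademacher_power k) B = real (card {\<tau>\<in>signs I. P (\<Sum>i\<in>I. \<tau> i)}) / 2 ^ card I"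
  proof -
    let ?J = "{1..k} - I"
    have Un: "I \<union> ?J = {1..k}" using I by auto
    have m: "(\<Sum>i\<in>I. merge I ?J (\<tau>, \<rho>) i) = (\<Sum>i\<in>I. \<tau> i)" for \<tau> \<rho> :: "nat \<Rightarrow> real"
      by (intro sum.cong) (auto simp: merge_def)
    have card: "card {\<tau>\<in>signs S. Q \<tau>} = (\<Sum>\<tau>\<in>signs S. if Q \<tau> then 1 else 0)"
      if "finite S" for S :: "nat set" and Q
      using sum.inter_filter[OF finite_signs[OF that], of "\<lambda>_. 1 :: nat" Q] by simp
    have "card B = (\<Sum>\<tau>\<in>signs (I \<union> ?J). if P (\<Sum>i\<in>I. \<tau> i) then 1 else 0)"
      unfolding B_def spins_eq_signs Un by (rule card) simp
    also have "\<dots> = (\<Sum>\<tau>\<in>signs I. \<Sum>\<rho>\<in>signs ?J. if P (\<Sum>i\<in>I. \<tau> i) then 1 else 0)"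
      by (subst sum_signs_Un) (auto simp: m)
    also have "\<dots> = 2 ^ card ?J * (\<Sum>\<tau>\<in>signs I. if P (\<Sum>i\<in>I. \<tau> i) then 1 else 0)"
      by (simp add: card_signs sum_distrib_left mult.commute)
    also have "\<dots> = 2 ^ card ?J * card {\<tau>\<in>signs I. P (\<Sum>i\<in>I. \<tau> i)}"
      by (simp only: card[OF fin])
    finally have "real (card B) = 2 ^ card ?J * real (card {\<tau>\<in>signs I. P (\<Sum>i\<in>I. \<tau> i)})"
      by simp
    moreover have "card (I \<union> ?J) = card I + card ?J"
      using fin by (intro card_Un_disjoint) auto
    then have "(2 :: real) ^ k = 2 ^ (card I + card ?J)"
      unfolding Un by simp
    ultimately have "measure (rademacher_power k) B
        = 2 ^ card ?J * real (card {\<tau>\<in>signs I. P (\<Sum>i\<in>I. \<tau> i)}) / 2 ^ (card I + card ?J)"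
      unfolding measure_rademacher_power[OF B] by (simp only:)
    then show ?thesis
      by (simp add: power_add)
  qed
  ultimately have "\<kappa> / 6 \<le> \<bar>measure (gibbs_marginal 1 N x k) B - measure (rademacher_power k) B\<bar>"
    using P by simp
  also have "\<dots> \<le> tv_dist (gibbs_marginal 1 N x k) (rademacher_power k)"
  proof (rule abs_measure_diff_le_tv_dist)
    show "finite_measure (gibbs_marginal 1 N x k)"
      using k by (rule finite_measure_gibbs_marginal)
    show "finite_measure (rademacher_power k)"
      using prob_space_rademacher_power by (simp add: prob_space_def)
    show "B \<in> sets (gibbs_marginal 1 N x k)"
      using B unfolding gibbs_marginal_def PiM_count_space_signs by simp
  qed
  finally show ?thesis
    by (simp add: \<kappa>_def mult_ac)
qed

text \<open>The heavy direction depends on the patterns, so every sign vector is required to occur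
  \<open>n\<close> times; a block of the right pattern can then be picked afterwards. The bound on
  \<open>s\<close> is that of the block version with \<open>radius\<close> inserted.\<close>

lemma tv_dist_ge:
  assumes k: "k \<le> N" and n: "even n"
    and count: "\<And>u. u \<in> sign_vectors \<Longrightarrow> n \<le> card {i\<in>{1..k}. x i = u}"
    and s: "0 \<le> s" "s \<le> n / (8 * (real CARD('m))\<^sup>2 * sqrt N)"
  shows "s / (1 + s) / (72 * 2 ^ CARD('m)) \<le> tv_dist (gibbs_marginal 1 N x k) (rademacher_power k)"
proof -
  obtain u where u: "u \<in> sign_vectors"
    "integral\<^sup>L lborel field_weight / (4 * 2 ^ CARD('m))
      \<le> (\<integral>g. indicator {g. radius < \<bar>g \<bullet> u\<bar>} g * field_weight g \<partial>lborel)"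
    by (rule exists_heavy_direction)
  obtain I where I: "I \<subseteq> {i\<in>{1..k}. x i = u}" "card I = n"
    by (rule obtain_subset_with_card_n[OF count[OF u(1)]])
  have "n / (8 * (real CARD('m))\<^sup>2 * sqrt N) = n * radius\<^sup>2 / (2 * real N)"
  proof -
    have "radius\<^sup>2 = sqrt N / (4 * (real CARD('m))\<^sup>2)"
      by (simp add: radius_def power_divide power_mult_distrib)
    then have "n * radius\<^sup>2 / (2 * real N) = n / (8 * (real CARD('m))\<^sup>2) * (sqrt N / N)"
      by simp
    also have "sqrt N / N = 1 / sqrt N"
      by (simp add: sqrt_divide_self_eq inverse_eq_divide)
    finally show ?thesis
      by simp
  qed
  with s have s': "s \<le> card I * radius\<^sup>2 / (2 * real N)"
    using I by simp
  show ?thesis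
    using k _ _ _ u(2) s(1) s' by (rule tv_dist_ge_of_block) (use I n in auto)
qed

end

section \<open>Random patterns\<close>

context hopfield_disorder
begin

lemma sign_patterns:
  assumes "1 \<le> N" "\<omega> \<in> space P"
  shows "sign_patterns N (\<lambda>i. \<xi> i \<omega>)"
  using assms pm_one by unfold_locales auto

lemma measurable_pattern: "i \<in> {1..N} \<Longrightarrow> random_variable borel (\<xi> i)"
  using indep_vectors by (simp add: indep_vars_def)

lemma sets_pattern_eq: "i \<in> {1..N} \<Longrightarrow> {\<omega> \<in> space P. \<xi> i \<omega> = u} \<in> events"
  using measurable_sets[OF measurable_pattern, of i "{u}"] by (simp add: vimage_def Int_def conj_commute)

lemma pattern_in_sign_vectors: "i \<in> {1..N} \<Longrightarrow> \<omega> \<in> space P \<Longrightarrow> \<xi> i \<omega> \<in> sign_vectors"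
  using pm_one by (simp add: sign_vectors_def)

text \<open>The first \<open>N\<close> patterns jointly take only finitely many values, so any
  property of them alone is a finite union of measurable atoms. The hypothesis expresses that
  \<open>Q\<close> ignores all other indices.\<close>

lemma sets_pattern_event:
  assumes "\<And>x. Q (restrict x {1..N}) \<longleftrightarrow> Q x"
  shows "{\<omega> \<in> space P. Q (\<lambda>i. \<xi> i \<omega>)} \<in> events"
proof -
  let ?V = "{1..N} \<rightarrow>\<^sub>E (sign_vectors :: (real ^ 'm) set)"
  let ?F = "\<lambda>\<omega>. \<lambda>i\<in>{1..N}. \<xi> i \<omega>"
  have fin: "finite ?V"
    by (intro finite_PiE) (auto intro: finite_sign_vectors)
  have "?F \<in> P \<rightarrow>\<^sub>M count_space ?V"
  proof (subst measurable_count_space_eq2[OF fin], intro conjI ballI)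
    show "?F \<in> space P \<rightarrow> ?V"
      using pattern_in_sign_vectors by auto
    fix v assume v: "v \<in> ?V"
    have "?F -` {v} \<inter> space P = {\<omega> \<in> space P. \<forall>i\<in>{1..N}. \<xi> i \<omega> = v i}"
      using v by (auto simp: PiE_iff extensional_def fun_eq_iff restrict_def)
    also have "\<dots> \<in> events"
      by (intro sets.sets_Collect_finite_All sets_pattern_eq) auto
    finally show "?F -` {v} \<inter> space P \<in> events" .
  qed
  then have "?F -` {v \<in> ?V. Q v} \<inter> space P \<in> events"
    by (rule measurable_sets) auto
  also have "?F -` {v \<in> ?V. Q v} \<inter> space P = {\<omega> \<in> space P. Q (\<lambda>i. \<xi> i \<omega>)}"
  proof -
    have "?F \<omega> \<in> ?V" if "\<omega> \<in> space P" for \<omega>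
      using pattern_in_sign_vectors that by auto
    then show ?thesis
      using assms by blast
  qed
  finally show ?thesis .
qed

text \<open>A variable with values in {-1, 1} is 1 minus twice the indicator of the value -1, so
  mean 0 fixes that probability.\<close>

lemma prob_coordinate:
  assumes i: "i \<in> {1..N}" and s: "s \<in> {-1, 1}"
  shows "prob {\<omega> \<in> space P. \<xi> i \<omega> $ \<nu> = s} = 1 / 2"
proof -
  have [measurable]: "(\<lambda>\<omega>. \<xi> i \<omega> $ \<nu>) \<in> borel_measurable P"
    by (rule measurable_compose[OF measurable_pattern[OF i]])
       (intro borel_measurable_continuous_onI continuous_intros)
  let ?A = "\<lambda>s. {\<omega> \<in> space P. \<xi> i \<omega> $ \<nu> = s}"
  have A: "?A s \<in> events" for s
    by measurable
  have "0 = expectation (\<lambda>\<omega>. \<xi> i \<omega> $ \<nu>)"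
    using mean[OF i] by simp
  also have "\<dots> = expectation (\<lambda>\<omega>. 1 - 2 * indicator (?A (-1)) \<omega>)"
    using pm_one[OF i, of _ \<nu>] by (intro Bochner_Integration.integral_cong) (auto split: split_indicator)
  also have "\<dots> = 1 - 2 * prob (?A (-1))"
  proof -
    have "integrable P (indicator (?A (-1)) :: 'a \<Rightarrow> real)"
      using A[of "-1"] by (intro integrable_real_indicator) (simp_all add: emeasure_eq_measure)
    then show ?thesis
      using A[of "-1"] by (subst Bochner_Integration.integral_diff) (simp_all add: prob_space)
  qed
  finally have m: "prob (?A (-1)) = 1 / 2" by simp
  have "?A 1 = space P - ?A (-1)"
    using pm_one[OF i, of _ \<nu>] by auto
  then have "prob (?A 1) = 1 / 2"
    using prob_compl[OF A[of "-1"]] m by simp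
  with m s show ?thesis by auto
qed

lemma prob_pattern_eq:
  assumes i: "i \<in> {1..N}" and u: "u \<in> sign_vectors"
  shows "prob {\<omega> \<in> space P. \<xi> i \<omega> = u} = 1 / 2 ^ CARD('m)"
proof -
  have "{\<omega> \<in> space P. \<xi> i \<omega> = u} = (\<Inter>\<nu>\<in>UNIV. (\<lambda>\<omega>. \<xi> i \<omega> $ \<nu>) -` {u $ \<nu>} \<inter> space P)"
    by (auto simp: vec_eq_iff)
  also have "prob \<dots> = (\<Prod>\<nu>\<in>UNIV. prob ((\<lambda>\<omega>. \<xi> i \<omega> $ \<nu>) -` {u $ \<nu>} \<inter> space P))"
    using indep_coordinates[OF i] by (rule indep_varsD) auto
  also have "\<dots> = (\<Prod>\<nu>\<in>(UNIV :: 'm set). 1 / 2)"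
  proof (intro prod.cong refl)
    fix \<nu>
    have "(\<lambda>\<omega>. \<xi> i \<omega> $ \<nu>) -` {u $ \<nu>} \<inter> space P = {\<omega> \<in> space P. \<xi> i \<omega> $ \<nu> = u $ \<nu>}"
      by auto
    then show "prob ((\<lambda>\<omega>. \<xi> i \<omega> $ \<nu>) -` {u $ \<nu>} \<inter> space P) = 1 / 2"
      using prob_coordinate[OF i, of "u $ \<nu>" \<nu>] u by (simp add: sign_vectors_def)
  qed
  finally show ?thesis by (simp add: power_divide)
qed

text \<open>The occurrences of \<open>u\<close> are a sum of independent indicators with mean k /
  2^M. Hoeffding's inequality for a deviation of half the mean gives the exponent 2 (k / 2^(M+1))^2
  / k = k / (2 * 4^M).\<close>

lemma prob_count_le:
  assumes k: "0 < k" "k \<le> N" and u: "u \<in> sign_vectors"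
  shows "prob {\<omega> \<in> space P. real (card {i\<in>{1..k}. \<xi> i \<omega> = u}) \<le> k / 2 ^ (CARD('m) + 1)}
    \<le> exp (- (k / (2 * 4 ^ CARD('m))))"
proof -
  let ?X = "\<lambda>i \<omega>. indicator {u} (\<xi> i \<omega>) :: real"
  have indep: "indep_vars (\<lambda>_. borel) ?X {1..k}"
  proof (rule indep_vars_compose2[where M' = "\<lambda>_. borel" and X = \<xi> and Y = "\<lambda>_. indicator {u}"])
    show "indep_vars (\<lambda>_. borel) \<xi> {1..k}"
      using indep_vectors by (rule indep_vars_subset) (use k in auto)
  qed auto
  interpret H: Hoeffding_ineq P "{1..k}" ?X "\<lambda>_. 0" "\<lambda>_. 1" "\<Sum>i\<in>{1..k}. expectation (?X i)"
    by unfold_locales (use indep in \<open>auto split: split_indicator\<close>)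
  have "expectation (?X i) = 1 / 2 ^ CARD('m)" if "i \<in> {1..k}" for i
  proof -
    have i: "i \<in> {1..N}" using that k by auto
    have "expectation (?X i) = expectation (indicator {\<omega> \<in> space P. \<xi> i \<omega> = u})"
      by (intro Bochner_Integration.integral_cong) (auto split: split_indicator)
    then show ?thesis
      using sets_pattern_eq[OF i] prob_pattern_eq[OF i u] by simp
  qed
  then have mean_eq: "(\<Sum>i\<in>{1..k}. expectation (?X i)) = k / 2 ^ CARD('m)"
    by simp
  have count: "(\<Sum>i\<in>{1..k}. ?X i \<omega>) = real (card {i\<in>{1..k}. \<xi> i \<omega> = u})" for \<omega>
  proof -
    have "(\<Sum>i\<in>{1..k}. ?X i \<omega>) = (\<Sum>i\<in>{1..k}. if \<xi> i \<omega> = u then 1 else 0)"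
      by (intro sum.cong) (auto simp: indicator_def)
    also have "\<dots> = real (card ({1..k} \<inter> {i. \<xi> i \<omega> = u}))"
      by (simp add: sum.If_cases)
    also have "{1..k} \<inter> {i. \<xi> i \<omega> = u} = {i\<in>{1..k}. \<xi> i \<omega> = u}"
      by auto
    finally show ?thesis .
  qed
  let ?e = "real k / 2 ^ (CARD('m) + 1)"
  have "prob {\<omega> \<in> space P. (\<Sum>i\<in>{1..k}. ?X i \<omega>) \<le> (\<Sum>i\<in>{1..k}. expectation (?X i)) - ?e}
      \<le> exp (- 2 * ?e\<^sup>2 / (\<Sum>i\<in>{1..k}. (1 - 0)\<^sup>2))"
    using k by (intro H.Hoeffding_ineq_le) auto
  also have "- 2 * ?e\<^sup>2 / (\<Sum>i\<in>{1..k}. (1 - 0)\<^sup>2) = - (k / (2 * 4 ^ CARD('m)))"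
  proof -
    have "- 2 * (k / (2 * p))\<^sup>2 / k = - (k / (2 * p\<^sup>2))" if "0 < p" for p :: real
      using that k by (simp add: power2_eq_square field_simps)
    from this[of "2 ^ CARD('m)"]
    have "- 2 * ?e\<^sup>2 / k = - (k / (2 * (2 ^ CARD('m))\<^sup>2))"
      by simp
    also have "(2 ^ CARD('m))\<^sup>2 = (4 :: real) ^ CARD('m)"
      unfolding power_mult[symmetric] mult.commute[of _ "2 :: nat"] unfolding power_mult by simp
    finally show ?thesis by simp
  qed
  also have "(\<Sum>i\<in>{1..k}. expectation (?X i)) - ?e = ?e"
    unfolding mean_eq by (simp add: field_simps)
  finally show ?thesis
    unfolding count .
qed

text \<open>Union bound over the at most 2^M sign vectors.\<close>

lemma prob_all_counts:
  assumes k: "0 < k" "k \<le> N"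
  shows "1 - 2 ^ CARD('m) * exp (- (k / (2 * 4 ^ CARD('m))))
    \<le> prob {\<omega> \<in> space P. \<forall>u\<in>sign_vectors. k / 2 ^ (CARD('m) + 1) \<le> real (card {i\<in>{1..k}. \<xi> i \<omega> = u})}"
    (is "_ \<le> prob ?G")
proof -
  let ?B = "\<lambda>u. {\<omega> \<in> space P. real (card {i\<in>{1..k}. \<xi> i \<omega> = u}) \<le> k / 2 ^ (CARD('m) + 1)}"
  have eq: "{i\<in>{1..k}. restrict x {1..N} i = u} = {i\<in>{1..k}. x i = u}" for x :: "nat \<Rightarrow> real ^ 'm" and u
    using k by auto
  have B: "?B u \<in> events" for u
    by (rule sets_pattern_event[where Q = "\<lambda>x. real (card {i\<in>{1..k}. x i = u}) \<le> k / 2 ^ (CARD('m) + 1)"])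
       (simp only: eq)
  have G: "?G \<in> events"
    by (rule sets_pattern_event[where
        Q = "\<lambda>x. \<forall>u\<in>sign_vectors. k / 2 ^ (CARD('m) + 1) \<le> real (card {i\<in>{1..k}. x i = u})"])
       (simp only: eq)
  have "1 - prob ?G = prob (space P - ?G)"
    using G by (rule prob_compl[symmetric])
  also have "\<dots> \<le> prob (\<Union>u\<in>sign_vectors. ?B u)"
  proof (rule finite_measure_mono)
    show "space P - ?G \<subseteq> (\<Union>u\<in>sign_vectors. ?B u)"
    proof
      fix \<omega> assume \<omega>: "\<omega> \<in> space P - ?G"
      then obtain u where u: "u \<in> sign_vectors"
        "\<not> k / 2 ^ (CARD('m) + 1) \<le> real (card {i\<in>{1..k}. \<xi> i \<omega> = u})"
        by blast
      from u(2) have "real (card {i\<in>{1..k}. \<xi> i \<omega> = u}) \<le> k / 2 ^ (CARD('m) + 1)"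
        by (simp only: not_le less_imp_le)
      with \<omega> u(1) show "\<omega> \<in> (\<Union>u\<in>sign_vectors. ?B u)"
        by blast
    qed
    show "(\<Union>u\<in>sign_vectors. ?B u) \<in> events"
      using finite_sign_vectors B by (rule sets.finite_UN)
  qed
  also have "\<dots> \<le> (\<Sum>u\<in>sign_vectors. prob (?B u))"
    using B by (intro finite_measure_subadditive_finite finite_sign_vectors) blast
  also have "\<dots> \<le> (\<Sum>u\<in>(sign_vectors :: (real ^ 'm) set). exp (- (k / (2 * 4 ^ CARD('m)))))"
    using k by (intro sum_mono prob_count_le)
  also have "\<dots> = card (sign_vectors :: (real ^ 'm) set) * exp (- (k / (2 * 4 ^ CARD('m))))"
    by simp
  also have "\<dots> \<le> 2 ^ CARD('m) * exp (- (k / (2 * 4 ^ CARD('m))))"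
    using of_nat_mono[OF card_sign_vectors_le[where 'm = 'm], where 'a = real]
    by (intro mult_right_mono) auto
  finally show ?thesis by simp
qed

lemma prob_tv_dist_ge:
  assumes k: "0 < k" "k \<le> N" and n: "even n" "real n \<le> k / 2 ^ (CARD('m) + 1)"
    and s: "0 \<le> s" "s \<le> n / (8 * (real CARD('m))\<^sup>2 * sqrt N)"
    and t: "t \<le> s / (1 + s) / (72 * 2 ^ CARD('m))"
  shows "1 - 2 ^ CARD('m) * exp (- (k / (2 * 4 ^ CARD('m))))
    \<le> prob {\<omega> \<in> space P. t \<le> tv_dist (gibbs_marginal 1 N (\<lambda>i. \<xi> i \<omega>) k) (rademacher_power k)}"
proof -
  \<comment> \<open>The marginal sees only the patterns with index up to \<open>N\<close>, so the
    event in question is measurable by \<open>sets_pattern_event\<close>.\<close>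
  have overlap: "overlap N (restrict x {1..N}) = overlap N x" for x :: "nat \<Rightarrow> real ^ 'm"
    by (auto simp: overlap_def fun_eq_iff)
  have "gibbs_marginal 1 N (restrict x {1..N}) k = gibbs_marginal 1 N x k" for x :: "nat \<Rightarrow> real ^ 'm"
    unfolding gibbs_marginal_def gibbs_def partition_function_def gibbs_weight_def overlap ..
  then have "{\<omega> \<in> space P. t \<le> tv_dist (gibbs_marginal 1 N (\<lambda>i. \<xi> i \<omega>) k) (rademacher_power k)} \<in> events"
    by (intro sets_pattern_event[where Q = "\<lambda>x. t \<le> tv_dist (gibbs_marginal 1 N x k) (rademacher_power k)"]) simp
  moreover have "t \<le> tv_dist (gibbs_marginal 1 N (\<lambda>i. \<xi> i \<omega>) k) (rademacher_power k)"
    if \<omega>: "\<omega> \<in> space P"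
      and count: "\<forall>u\<in>sign_vectors. k / 2 ^ (CARD('m) + 1) \<le> real (card {i\<in>{1..k}. \<xi> i \<omega> = u})" for \<omega>
  proof -
    interpret S: sign_patterns N "\<lambda>i. \<xi> i \<omega>"
      using k \<omega> by (intro sign_patterns) auto
    have "n \<le> card {i\<in>{1..k}. \<xi> i \<omega> = u}" if "u \<in> sign_vectors" for u
    proof -
      have "real n \<le> real (card {i\<in>{1..k}. \<xi> i \<omega> = u})"
        using n(2) bspec[OF count that] by (rule order_trans)
      then show ?thesis by simp
    qed
    from S.tv_dist_ge[OF k(2) n(1) this s] t show ?thesis
      by (rule order_trans[rotated])
  qed
  ultimately show ?thesis
    by (intro order_trans[OF prob_all_counts[OF k]] finite_measure_mono) auto
qed

end

section \<open>Choice of the constants and passage to the limit\<close>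

theorem theorem1p5:
  fixes c :: real
  assumes "c > 0"
  shows "\<exists>b > 0. \<forall>k :: nat \<Rightarrow> nat. (\<lambda>N. real (k N) / sqrt (real N)) \<longlonglongrightarrow> c \<longrightarrow>
    (\<forall>(P :: nat \<Rightarrow> 'a measure) (\<xi> :: nat \<Rightarrow> nat \<Rightarrow> 'a \<Rightarrow> real ^ 'm).
      (\<forall>N\<ge>1. hopfield_disorder (P N) N (\<xi> N)) \<longrightarrow>
      (\<forall>\<delta> > 0. (\<lambda>N. measure (P N) {\<omega> \<in> space (P N).
          tv_dist (gibbs_marginal 1 N (\<lambda>i. \<xi> N i \<omega>) (k N)) (rademacher_power (k N)) \<ge> b - \<delta>})
        \<longlonglongrightarrow> 1))"
proof -
  define M where "M = CARD('m)"
  have M: "0 < M" by (simp add: M_def)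
  \<comment> \<open>Half of the limit of n / (8 M^2 sqrt N) when n is asymptotically k / 2^(M+1);
    the spare factor 2 makes the bound on \<open>s\<close> hold for all large N.\<close>
  define s where "s = c / (2 ^ (M + 5) * (real M)\<^sup>2)"
  define b where "b = s / (1 + s) / (72 * 2 ^ M)"
  have s: "0 < s" using assms M by (simp add: s_def)
  then have b: "0 < b" by (simp add: b_def)
  show ?thesis
  proof (intro exI[of _ b] conjI b allI impI)
    fix k :: "nat \<Rightarrow> nat" and P :: "nat \<Rightarrow> 'a measure" and \<xi> :: "nat \<Rightarrow> nat \<Rightarrow> 'a \<Rightarrow> real ^ 'm" and \<delta> :: real
    assume lim: "(\<lambda>N. real (k N) / sqrt (real N)) \<longlonglongrightarrow> c"
      and disorder: "\<forall>N\<ge>1. hopfield_disorder (P N) N (\<xi> N)" and \<delta>: "0 < \<delta>"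
    let ?p = "\<lambda>N. measure (P N) {\<omega> \<in> space (P N).
        tv_dist (gibbs_marginal 1 N (\<lambda>i. \<xi> N i \<omega>) (k N)) (rademacher_power (k N)) \<ge> b - \<delta>}"
    let ?l = "\<lambda>N. 1 - 2 ^ M * exp (- (real (k N) / (2 * 4 ^ M)))"
    \<comment> \<open>The largest even number not exceeding k / 2^(M+1). Evenness is what the
      quantile lemma asks for, and the rounding costs at most 2.\<close>
    define n where "n = (\<lambda>N. 2 * (k N div 2 ^ (M + 2)))"
    have sqrt_top: "filterlim (\<lambda>N. sqrt (real N)) at_top sequentially"
      by (rule filterlim_compose[OF sqrt_at_top filterlim_real_sequentially])
    have "filterlim (\<lambda>N. real (k N) / sqrt (real N) * sqrt (real N)) at_top sequentially"
      by (rule filterlim_tendsto_pos_mult_at_top[OF lim assms sqrt_top])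
    moreover have "\<forall>\<^sub>F N in sequentially. real (k N) / sqrt (real N) * sqrt (real N) = real (k N)"
      using eventually_gt_at_top[of 0] by eventually_elim simp
    ultimately have k_top: "filterlim (\<lambda>N. real (k N)) at_top sequentially"
      by (simp only: filterlim_cong[OF refl refl])
    have k_pos: "\<forall>\<^sub>F N in sequentially. 0 < k N"
      using filterlim_at_top_dense[THEN iffD1, OF k_top, rule_format, of 0] by simp
    have inv: "(\<lambda>N. 1 / sqrt (real N)) \<longlonglongrightarrow> 0"
      using tendsto_inverse_0_at_top[OF sqrt_top] by (simp add: inverse_eq_divide)
    \<comment> \<open>For N > 0 this product is k / N; its convergence to 0 gives
      \<open>k N \<le> N\<close> eventually, which makes the marginal meaningful.\<close>
    have "(\<lambda>N. real (k N) / sqrt (real N) * (1 / sqrt (real N))) \<longlonglongrightarrow> c * 0"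
      by (intro tendsto_mult lim inv)
    then have "\<forall>\<^sub>F N in sequentially. real (k N) / sqrt (real N) * (1 / sqrt (real N)) < 1"
      by (rule order_tendstoD) simp
    then have k_le: "\<forall>\<^sub>F N in sequentially. k N \<le> N"
      using eventually_gt_at_top[of 0] by eventually_elim simp
    have "(\<lambda>N. (real (k N) / sqrt (real N) / 2 ^ (M + 1) - 2 * (1 / sqrt (real N))) / (8 * (real M)\<^sup>2))
        \<longlonglongrightarrow> (c / 2 ^ (M + 1) - 2 * 0) / (8 * (real M)\<^sup>2)"
      using M by (intro tendsto_intros lim inv) auto
    moreover have "s < (c / 2 ^ (M + 1) - 2 * 0) / (8 * (real M)\<^sup>2)"
    proof -
      have "(c / 2 ^ (M + 1) - 2 * 0) / (8 * (real M)\<^sup>2) = 2 * s"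
        by (simp add: s_def power_add)
      then show ?thesis using s by linarith
    qed
    ultimately have "\<forall>\<^sub>F N in sequentially.
        s < (real (k N) / sqrt (real N) / 2 ^ (M + 1) - 2 * (1 / sqrt (real N))) / (8 * (real M)\<^sup>2)"
      by (rule order_tendstoD)
    then have s_le: "\<forall>\<^sub>F N in sequentially. s \<le> real (n N) / (8 * (real M)\<^sup>2 * sqrt N)"
    proof eventually_elim
      case (elim N)
      have "k N \<le> 2 ^ (M + 2) * (k N div 2 ^ (M + 2)) + 2 ^ (M + 2)"
        by (metis add_left_mono mod_less_divisor less_imp_le mult_div_mod_eq zero_less_numeral zero_less_power)
      then have "real (k N) \<le> real (2 ^ (M + 2) * (k N div 2 ^ (M + 2)) + 2 ^ (M + 2))"
        by (rule of_nat_mono)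
      then have "real (k N) / 2 ^ (M + 1) - 2 \<le> real (n N)"
        by (simp add: n_def field_simps)
      then have "(real (k N) / 2 ^ (M + 1) - 2) / (8 * (real M)\<^sup>2 * sqrt N) \<le> real (n N) / (8 * (real M)\<^sup>2 * sqrt N)"
        by (rule divide_right_mono) simp
      moreover have "(real (k N) / sqrt (real N) / 2 ^ (M + 1) - 2 * (1 / sqrt (real N))) / (8 * (real M)\<^sup>2)
          = (real (k N) / 2 ^ (M + 1) - 2) / (8 * (real M)\<^sup>2 * sqrt N)"
        by (simp add: diff_divide_distrib mult_ac)
      ultimately show ?case using elim by linarith
    qed
    have n_le: "real (n N) \<le> real (k N) / 2 ^ (M + 1)" for N
    proof -
      have "2 ^ (M + 2) * (k N div 2 ^ (M + 2)) \<le> k N" by simp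
      then have "real (2 ^ (M + 2) * (k N div 2 ^ (M + 2))) \<le> real (k N)" by (rule of_nat_mono)
      then show ?thesis by (simp add: n_def field_simps)
    qed
    have lower: "\<forall>\<^sub>F N in sequentially. ?l N \<le> ?p N"
      using k_pos k_le s_le eventually_ge_at_top[of 1]
    proof eventually_elim
      case (elim N)
      interpret H: hopfield_disorder "P N" N "\<xi> N"
        using disorder elim by blast
      show ?case
        unfolding M_def
      proof (rule H.prob_tv_dist_ge[where n = "n N" and s = s])
        show "b - \<delta> \<le> s / (1 + s) / (72 * 2 ^ CARD('m))"
          using \<delta> by (simp add: b_def M_def)
      qed (use elim n_le[of N] s in \<open>auto simp: n_def M_def\<close>)
    qed
    have upper: "\<forall>\<^sub>F N in sequentially. ?p N \<le> 1"
      using eventually_ge_at_top[of 1]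
    proof eventually_elim
      case (elim N)
      interpret H: hopfield_disorder "P N" N "\<xi> N"
        using disorder elim by blast
      show ?case by (rule H.prob_le_1)
    qed
    \<comment> \<open>Since \<open>k N\<close> tends to infinity and M is fixed, the failure
      probability from the union bound vanishes.\<close>
    have "filterlim (\<lambda>N. real (k N) * (1 / (2 * 4 ^ M))) at_top sequentially"
      by (rule filterlim_at_top_mult_tendsto_pos[OF tendsto_const _ k_top]) simp
    then have "(\<lambda>N. exp (- (real (k N) / (2 * 4 ^ M)))) \<longlonglongrightarrow> 0"
      by (intro filterlim_compose[OF exp_at_bot] filterlim_compose[OF filterlim_uminus_at_bot_at_top]) simp
    then have "?l \<longlonglongrightarrow> 1 - 2 ^ M * 0"
      by (intro tendsto_intros)
    then show "?p \<longlonglongrightarrow> 1"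
      by (intro tendsto_sandwich[OF lower upper _ tendsto_const]) simp
  qed
qed

end
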